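(* Let $1/2<\rho<2/3$, let $\mu^{(\rho)}$ be the Bernoulli product measure of density $\rho$ on $\{0,1\}^{\mathbb Z}$, let $V=\{\eta\in X_\rho: 0\in P(\eta)\}$, and let $\mu$ be $\mu^{(\rho)}$ conditioned on $V$. For $\eta\in V$ index the points of $P(\eta)$ and $Q(\eta)$ increasingly as $(p_k)_{k\in\mathbb Z}$ and $(q_k)_{k\in\mathbb Z}$ with $p_0=0$ and $p_k<q_k<p_{k+1}$ for all $k$. Define $\mathbb Z^2$-valued random variables $(Y_j)_{j\in\mathbb Z}$ on $V$ by $$Y_{2k}=\bigl(p_k-q_{k-1},\,h(p_k)-h(q_{k-1})\bigr),\qquad Y_{2k+1}=\bigl(q_k-p_k,\,h(q_k)-h(p_k)\bigr),\qquad k\in\mathbb Z.$$ Then, under $\mu$, $(Y_j)_{j\in\mathbb Z}$ is a Markov process (that is, for every $j\in\mathbb Z$ the conditional distribution of $Y_{j+1}$ given $(Y_i)_{i\le j}$ depends only on $Y_j$).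
   Context: $X_\rho$ is the set of $\eta\in\{0,1\}^{\mathbb Z}$ with $\lim_{N\to\infty}\frac1N\sum_{i=1}^N\eta(i)=\lim_{N\to\infty}\frac1N\sum_{i=-N}^{-1}\eta(i)=\rho$; $\mu^{(\rho)}(X_\rho)=1$. For $\eta\in X_\rho$, $h:\mathbb Z\to\mathbb Z$ is defined by $h(0)=0$, $h(k)-h(k-1)=(-1)^{\eta(k)}$, and $h^*(k)=h(k)+k/3$. Let $A=\{a\in\mathbb Z:h(a)>\sup_{r>a}h(r)\}$ and $B=\{b\in\mathbb Z:h^*(b)<\inf_{r>b}h^*(r)\}$; for $1/2<\rho<2/3$ these are disjoint and unbounded above and below. Index them increasingly as $(a_j)_{j\in\mathbb Z}$, $(b_j)_{j\in\mathbb Z}$. $P(\eta)$ is the set of those $a_j\in A$ for which there is a $b\in B$ with $a_{j-1}<b<a_j$, and $Q(\eta)$ is the set of those $b_j\in B$ for which there is an $a\in A$ with $b_{j-1}<a<b_j$. Points of $P(\eta)$ and $Q(\eta)$ alternate on $\mathbb Z$. One has $\mu^{(\rho)}(V)>0$. The Markov process is not required to be time-homogeneous. *)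

theory Defs
  imports "HOL-Probability.Probability"
begin

text \<open>Configurations in $\{0,1\}^{\mathbb Z}$ are functions \<open>int \<Rightarrow> bool\<close>, with \<open>True\<close> for 1
  and \<open>False\<close> for 0.\<close>

type_synonym config = "int \<Rightarrow> bool"

definition bernoulli_product :: "real \<Rightarrow> config measure" where
  "bernoulli_product \<rho> = (\<Pi>\<^sub>M i\<in>(UNIV :: int set). measure_pmf (bernoulli_pmf \<rho>))"

definition X_set :: "real \<Rightarrow> config set" where
  "X_set \<rho> = {\<eta>.
     (\<lambda>N::nat. 1 / real N * (\<Sum>i = 1..int N. of_bool (\<eta> i))) \<longlonglongrightarrow> \<rho> \<and>
     (\<lambda>N::nat. 1 / real N * (\<Sum>i = - int N..-1. of_bool (\<eta> i))) \<longlonglongrightarrow> \<rho>}"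

text \<open>At most one of the two sums below is nonempty. The lemmas \<open>height_zero\<close>, \<open>height_step\<close> and
  \<open>height_unique\<close> show that this is the function determined by $h(0) = 0$ and
  $h(k) - h(k-1) = (-1)^{\eta(k)}$.\<close>

definition height :: "config \<Rightarrow> int \<Rightarrow> int" where
  "height \<eta> k = (\<Sum>i\<in>{0<..k}. (-1) ^ of_bool (\<eta> i)) - (\<Sum>i\<in>{k<..0}. (-1) ^ of_bool (\<eta> i))"

lemma height_zero: "height \<eta> 0 = 0"
  by (simp add: height_def)

lemma height_step: "height \<eta> k - height \<eta> (k - 1) = (-1) ^ of_bool (\<eta> k)"
proof (cases "k > 0")
  case True
  then have "{0<..k} = insert k {0<..k - 1}" by auto
  with True show ?thesis by (simp add: height_def)
next
  case False
  then have "{k - 1<..0} = insert k {k<..0}" by auto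
  with False show ?thesis by (simp add: height_def)
qed

lemma height_unique:
  assumes "g 0 = 0" and "\<And>k. g k - g (k - 1) = (-1) ^ of_bool (\<eta> k)"
  shows "g = height \<eta>"
proof
  fix k :: int
  show "g k = height \<eta> k"
  proof (induction k rule: int_induct[where k = 0])
    case base
    show ?case using assms(1) by (simp add: height_zero)
  next
    case (step1 i)
    then show ?case using assms(2)[of "i + 1"] height_step[of \<eta> "i + 1"] by simp
  next
    case (step2 i)
    then show ?case using assms(2)[of i] height_step[of \<eta> i] by simp
  qed
qed

definition height_star :: "config \<Rightarrow> int \<Rightarrow> real" where
  "height_star \<eta> k = real_of_int (height \<eta> k) + real_of_int k / 3"

text \<open>Supremum and infimum are taken in the extended reals, so an unbounded path gives
  $\pm\infty$ and not an unspecified value.\<close>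

definition A_set :: "config \<Rightarrow> int set" where
  "A_set \<eta> = {a. ereal (real_of_int (height \<eta> a)) > (SUP r\<in>{a<..}. ereal (real_of_int (height \<eta> r)))}"

definition B_set :: "config \<Rightarrow> int set" where
  "B_set \<eta> = {b. ereal (height_star \<eta> b) < (INF r\<in>{b<..}. ereal (height_star \<eta> r))}"

definition increasing_indexing :: "int set \<Rightarrow> (int \<Rightarrow> int) \<Rightarrow> bool" where
  "increasing_indexing S f \<longleftrightarrow> strict_mono f \<and> range f = S"

text \<open>An increasing indexing is unique up to a shift of the index, and the following two sets do not
  depend on that shift.\<close>

definition P_set :: "config \<Rightarrow> int set" where
  "P_set \<eta> = {a j | a j. increasing_indexing (A_set \<eta>) a \<and> (\<exists>b\<in>B_set \<eta>. a (j - 1) < b \<and> b < a j)}"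

definition Q_set :: "config \<Rightarrow> int set" where
  "Q_set \<eta> = {b j | b j. increasing_indexing (B_set \<eta>) b \<and> (\<exists>a\<in>A_set \<eta>. b (j - 1) < a \<and> a < b j)}"

definition V_set :: "real \<Rightarrow> config set" where
  "V_set \<rho> = {\<eta> \<in> X_set \<rho>. 0 \<in> P_set \<eta>}"

text \<open>The conditioned measure is regarded as a measure on \<open>V_set \<rho>\<close>, because the points
  $p_k$ and $q_k$ are defined only there.\<close>

definition mu_V :: "real \<Rightarrow> config measure" where
  "mu_V \<rho> = restrict_space (uniform_measure (bernoulli_product \<rho>) (V_set \<rho>)) (V_set \<rho>)"

definition p_point :: "config \<Rightarrow> int \<Rightarrow> int" where
  "p_point \<eta> = (THE p. increasing_indexing (P_set \<eta>) p \<and> p 0 = 0)"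

definition q_point :: "config \<Rightarrow> int \<Rightarrow> int" where
  "q_point \<eta> = (THE q. increasing_indexing (Q_set \<eta>) q \<and>
     (\<forall>k. p_point \<eta> k < q k \<and> q k < p_point \<eta> (k + 1)))"

definition Y_proc :: "int \<Rightarrow> config \<Rightarrow> int \<times> int" where
  "Y_proc j \<eta> = (let k = j div 2; p = p_point \<eta>; q = q_point \<eta>; h = height \<eta> in
     if even j then (p k - q (k - 1), h (p k) - h (q (k - 1)))
     else (q k - p k, h (q k) - h (p k)))"

lemma Y_proc_even:
  "Y_proc (2 * k) \<eta> = (p_point \<eta> k - q_point \<eta> (k - 1),
     height \<eta> (p_point \<eta> k) - height \<eta> (q_point \<eta> (k - 1)))"
  by (simp add: Y_proc_def Let_def)

lemma Y_proc_odd: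
  "Y_proc (2 * k + 1) \<eta> = (q_point \<eta> k - p_point \<eta> k,
     height \<eta> (q_point \<eta> k) - height \<eta> (p_point \<eta> k))"
  by (simp add: Y_proc_def Let_def)

text \<open>The sigma-algebra generated by $(Y_i)_{i \in I}$, for random variables $Y_i$ with values in
  the measurable space \<open>S\<close>.\<close>

definition sigma_gen :: "'w measure \<Rightarrow> 's measure \<Rightarrow> (int \<Rightarrow> 'w \<Rightarrow> 's) \<Rightarrow> int set \<Rightarrow> 'w measure" where
  "sigma_gen M S Y I =
     vimage_algebra (space M) (\<lambda>\<omega>. restrict (\<lambda>i. Y i \<omega>) I) (\<Pi>\<^sub>M i\<in>I. S)"

text \<open>The Markov property, without time-homogeneity: the conditional probability of each event
  $\{Y_{j+1} \in C\}$ given $(Y_i)_{i \le j}$ is almost surely its conditional probability given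
  $Y_j$ alone.\<close>

definition markov_process :: "'w measure \<Rightarrow> 's measure \<Rightarrow> (int \<Rightarrow> 'w \<Rightarrow> 's) \<Rightarrow> bool" where
  "markov_process M S Y \<longleftrightarrow>
     prob_space M \<and>
     (\<forall>j. Y j \<in> measurable M S) \<and>
     (\<forall>j. \<forall>C\<in>sets S. AE \<omega> in M.
        real_cond_exp M (sigma_gen M S Y {..j}) (indicator (Y (j + 1) -` C \<inter> space M)) \<omega> =
        real_cond_exp M (sigma_gen M S Y {j}) (indicator (Y (j + 1) -` C \<inter> space M)) \<omega>)"

end

theory Submission
  imports Defs
begin

text \<open>The height path is cut at the points \<open>p\<^sub>k\<close> and \<open>q\<^sub>k\<close>: \<open>q\<^sub>k\<close> is the first point of \<open>B\<close> after \<open>p\<^sub>k\<close>,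
  and \<open>p\<^sub>k\<^sub>+\<^sub>1\<close> is the first point of \<open>A\<close> after \<open>q\<^sub>k\<close>. At a cut, say \<open>p\<^sub>k\<close>, the past constrains the future
  only through \<open>p\<^sub>k \<in> A\<close> and \<open>q\<^sub>k\<^sub>-\<^sub>1 \<in> B\<close>, because earlier cut points in \<open>A\<close> have larger \<open>h\<close> than \<open>p\<^sub>k\<close> and
  earlier cut points in \<open>B\<close> have smaller \<open>h\<^sup>*\<close> than \<open>q\<^sub>k\<^sub>-\<^sub>1\<close>; seen from \<open>p\<^sub>k\<close>, these two conditions depend
  only on the last increment \<open>Y\<^sub>2\<^sub>k\<close>. Hence two configurations with the same \<open>Y\<^sub>0\<close> (or the same \<open>Y\<^sub>1\<close>) may
  exchange their futures without changing their pasts, so by independence of the coordinates the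
  events in question are rectangles; this is the Markov property at times 0 and 1. Other times
  are reduced to these two by recentring at \<open>p\<^sub>k\<close>, which preserves the conditioned measure.\<close>

section \<open>Interlacing subsets of the integers\<close>

text \<open>The points \<open>p_k\<close> and \<open>q_k\<close> are recognised only by looking at
  the whole future, so they are not stopping times, and independence is available only at a fixed
  coordinate. This singles out times 0 and 1: on \<open>V_core\<close> the cut \<open>p_0\<close>
  lies at 0, and on the event \<open>Y_1 = y\<close> the cut \<open>q_0\<close> lies at
  \<open>fst y\<close>. A general \<open>p_k\<close> has a random location, and recentring treats
  each of its values separately. Both components of \<open>Y_j\<close> matter: together they locate
  the previous cut relative to the present one, which decides whether a new future keeps that cut in
  \<open>A\<close> or \<open>B\<close>. The density enters through two drifts: \<open>h\<close> has
  drift 1 - 2\<rho> < 0 and \<open>h^*\<close> has drift 4/3 - 2\<rho> > 0, so \<open>A\<close> and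
  \<open>B\<close> are unbounded on both sides. The exchange argument works with this consequence
  alone, on \<open>V_core\<close>; limits return when \<open>V_core\<close> is compared with
  \<open>V_set\<close>.\<close>

definition biinfinite :: "int set \<Rightarrow> bool" where
  "biinfinite S \<longleftrightarrow> (\<forall>n. (\<exists>s\<in>S. s < n) \<and> (\<exists>s\<in>S. n < s))"

lemma biinfinite_next:
  assumes "biinfinite S"
  obtains s where "s \<in> S" "n < s" "\<And>t. t \<in> S \<Longrightarrow> n < t \<Longrightarrow> s \<le> t"
proof -
  obtain u where u: "u \<in> S" "n < u" using assms by (auto simp: biinfinite_def)
  let ?T = "S \<inter> {n<..u}"
  have "finite ?T" "?T \<noteq> {}" using u by auto
  then have m: "Min ?T \<in> ?T" "\<And>t. t \<in> ?T \<Longrightarrow> Min ?T \<le> t" by (simp_all add: Min_in del: Int_iff)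
  show thesis
  proof
    show "Min ?T \<in> S" "n < Min ?T" using m(1) by auto
    show "Min ?T \<le> t" if "t \<in> S" "n < t" for t
      using m(1) m(2)[of t] that by (cases "t \<le> u") auto
  qed
qed

lemma biinfinite_prev:
  assumes "biinfinite S"
  obtains s where "s \<in> S" "s < n" "\<And>t. t \<in> S \<Longrightarrow> t < n \<Longrightarrow> t \<le> s"
proof -
  obtain u where u: "u \<in> S" "u < n" using assms by (auto simp: biinfinite_def)
  let ?T = "S \<inter> {u..<n}"
  have "finite ?T" "?T \<noteq> {}" using u by auto
  then have m: "Max ?T \<in> ?T" "\<And>t. t \<in> ?T \<Longrightarrow> t \<le> Max ?T" by (simp_all add: Max_in del: Int_iff)
  show thesis
  proof
    show "Max ?T \<in> S" "Max ?T < n" using m(1) by auto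
    show "t \<le> Max ?T" if "t \<in> S" "t < n" for t
      using m(1) m(2)[of t] that by (cases "u \<le> t") auto
  qed
qed

lemma strict_mono_int:
  fixes f :: "int \<Rightarrow> int"
  assumes "\<And>k. f k < f (k + 1)"
  shows "strict_mono f"
proof (rule strict_monoI)
  fix i j :: int
  assume "i < j"
  then show "f i < f j"
  proof (induction j rule: int_gr_induct)
    case base
    show ?case using assms .
  next
    case (step j)
    then show ?case using assms[of j] by simp
  qed
qed

lemma strict_mono_int_ge:
  fixes f :: "int \<Rightarrow> int"
  assumes "strict_mono f" "0 \<le> k"
  shows "f i + k \<le> f (i + k)"
  using assms(2)
proof (induction k rule: int_ge_induct)
  case base
  show ?case by simp
next
  case (step k)
  then show ?case using strict_monoD[OF assms(1), of "i + k" "i + (k + 1)"] by simp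
qed

text \<open>Strict increase in the integers means growth by at least 1 per index, so the indices
  \<open>k\<close> with \<open>f k \<le> n\<close> form a nonempty set bounded above; its maximum
  gives the bracket.\<close>

lemma strict_mono_int_bracket:
  fixes f :: "int \<Rightarrow> int"
  assumes f: "strict_mono f"
  obtains k where "f k \<le> n" "n < f (k + 1)"
proof -
  define K where "K = {k. f k \<le> n}"
  have lo: "f (- k) \<le> f 0 - k" if "0 \<le> k" for k
    using strict_mono_int_ge[OF f that, of "- k"] by simp
  have hi: "f 0 + k \<le> f k" if "0 \<le> k" for k
    using strict_mono_int_ge[OF f that, of 0] by simp
  have ne: "- \<bar>f 0 - n\<bar> \<in> K" using lo[of "\<bar>f 0 - n\<bar>"] by (simp add: K_def)
  have "n < f (\<bar>f 0 - n\<bar> + 1)" using hi[of "\<bar>f 0 - n\<bar> + 1"] by simp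
  then have K1: "k < \<bar>f 0 - n\<bar> + 1" if "k \<in> K" for k
    using that strict_mono_less[OF f, of k "\<bar>f 0 - n\<bar> + 1"] by (simp add: K_def)
  let ?L = "K \<inter> {- \<bar>f 0 - n\<bar>..\<bar>f 0 - n\<bar> + 1}"
  have m: "Max ?L \<in> ?L" "\<And>k. k \<in> ?L \<Longrightarrow> k \<le> Max ?L"
  proof -
    have "?L \<noteq> {}" using ne by force
    then show "Max ?L \<in> ?L" "\<And>k. k \<in> ?L \<Longrightarrow> k \<le> Max ?L"
      by (simp_all add: Max_in del: Int_iff)
  qed
  have "Max ?L + 1 \<notin> K"
  proof
    assume "Max ?L + 1 \<in> K"
    moreover from this have "Max ?L + 1 \<in> ?L" using m(1) K1 by force
    ultimately show False using m(2)[of "Max ?L + 1"] by simp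
  qed
  then show thesis using that[of "Max ?L"] m(1) by (simp add: K_def)
qed

lemma increasing_indexingD:
  assumes "increasing_indexing S f"
  shows "strict_mono f" "f k \<in> S" "s \<in> S \<Longrightarrow> \<exists>m. s = f m"
  using assms by (auto simp: increasing_indexing_def)

lemma increasing_indexing_gap:
  assumes "increasing_indexing S f" "s \<in> S" "f k < s" "s < f (k + 1)"
  shows False
  using assms increasing_indexingD[OF assms(1)] by (metis strict_mono_less zless_imp_add1_zle not_le)

text \<open>Iterate the successor in \<open>S\<close> upwards from \<open>x\<close> and the
  predecessor downwards; bracketing shows that no point of \<open>S\<close> is skipped.\<close>

lemma increasing_indexing_ex:
  assumes S: "biinfinite S" and x: "x \<in> S"
  obtains f where "increasing_indexing S f" "f 0 = x"
proof -
  have "\<forall>n. \<exists>s. s \<in> S \<and> n < s \<and> (\<forall>t\<in>S. n < t \<longrightarrow> s \<le> t)"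
    using biinfinite_next[OF S] by metis
  then obtain N where N: "\<And>n. N n \<in> S" "\<And>n. n < N n" "\<And>n t. t \<in> S \<Longrightarrow> n < t \<Longrightarrow> N n \<le> t"
    by metis
  have "\<forall>n. \<exists>s. s \<in> S \<and> s < n \<and> (\<forall>t\<in>S. t < n \<longrightarrow> t \<le> s)"
    using biinfinite_prev[OF S] by metis
  then obtain P where P: "\<And>n. P n \<in> S" "\<And>n. P n < n" "\<And>n t. t \<in> S \<Longrightarrow> t < n \<Longrightarrow> t \<le> P n"
    by metis
  define f where "f k = (if 0 \<le> k then (N ^^ nat k) x else (P ^^ nat (- k)) x)" for k :: int
  have inS: "f k \<in> S" for k
  proof -
    have "(N ^^ i) x \<in> S" "(P ^^ i) x \<in> S" for i by (cases i; simp add: x N P)+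
    then show ?thesis by (simp add: f_def)
  qed
  have succ: "f k < f (k + 1) \<and> (\<forall>t\<in>S. f k < t \<longrightarrow> f (k + 1) \<le> t)" for k
  proof (cases "0 \<le> k")
    case True
    then have "f (k + 1) = N (f k)" by (simp add: f_def nat_add_distrib)
    then show ?thesis using N by simp
  next
    case False
    then have "nat (- k) = Suc (nat (- (k + 1)))" by simp
    then have "f k = P (f (k + 1))" using False by (cases "k = -1") (simp_all add: f_def)
    then show ?thesis using P[of "f (k + 1)"] P(3)[of _ "f (k + 1)"] by force
  qed
  have sm: "strict_mono f" using succ by (intro strict_mono_int) blast
  have "range f = S"
  proof
    show "range f \<subseteq> S" using inS by auto
    show "S \<subseteq> range f"
    proof
      fix s assume s: "s \<in> S"
      obtain k where "f k \<le> s" "s < f (k + 1)" using strict_mono_int_bracket[OF sm] .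
      then have "s = f k" using succ[of k] s by force
      then show "s \<in> range f" by simp
    qed
  qed
  then show thesis using that[of f] sm by (simp add: increasing_indexing_def f_def)
qed

text \<open>Each of \<open>f (k - 1)\<close> and \<open>g (k - 1)\<close> occurs in the other
  enumeration strictly below the common value at \<open>k\<close>, so each bounds the other. Two
  different sets are allowed in order to compare a configuration with an altered one below a common
  cut.\<close>

lemma increasing_indexing_agree_below:
  assumes f: "increasing_indexing S f" and g: "increasing_indexing S' g"
    and eq: "f 0 = g 0" and S: "S \<inter> {..f 0} = S' \<inter> {..f 0}" and "k \<le> 0"
  shows "f k = g k"
  using \<open>k \<le> 0\<close>
proof (induction k rule: int_le_induct)
  case base
  show ?case by (fact eq)
next
  case (step k)
  note f' = increasing_indexingD[OF f] and g' = increasing_indexingD[OF g]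
  have "f (k - 1) \<le> f 0" "g (k - 1) \<le> f 0"
    using strict_mono_less_eq[OF f'(1), of "k - 1" 0] strict_mono_less_eq[OF g'(1), of "k - 1" 0]
      step.hyps eq by simp_all
  then have "f (k - 1) \<in> S'" "g (k - 1) \<in> S" using S f'(2) g'(2) by blast+
  then obtain m n where m: "f (k - 1) = g m" and n: "g (k - 1) = f n" using f'(3) g'(3) by metis
  have "g m < g k" using m f'(1) step.IH strict_mono_less[OF f'(1), of "k - 1" k] by simp
  then have "m \<le> k - 1" using g'(1) by (simp add: strict_mono_less)
  moreover have "f n < f k" using n step.IH strict_mono_less[OF g'(1), of "k - 1" k] by simp
  then have "n \<le> k - 1" using f'(1) by (simp add: strict_mono_less)
  ultimately show ?case using m n strict_mono_less_eq[OF f'(1), of n "k - 1"]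
      strict_mono_less_eq[OF g'(1), of m "k - 1"] by simp
qed

lemma increasing_indexing_unique:
  assumes f: "increasing_indexing S f" and g: "increasing_indexing S g" and eq: "f i = g i"
  shows "f = g"
proof
  fix k
  have shift: "increasing_indexing S (\<lambda>m. h (m + j))" if h: "increasing_indexing S h" for h j
    unfolding increasing_indexing_def
  proof
    show "strict_mono (\<lambda>m. h (m + j))"
      using increasing_indexingD(1)[OF h] by (simp add: strict_mono_def)
    have "range (\<lambda>m. h (m + j)) = range h"
      using surj_plus_right[of j] by (metis image_image)
    then show "range (\<lambda>m. h (m + j)) = S" using h by (simp add: increasing_indexing_def)
  qed
  show "f k = g k"
  proof (cases "k \<le> i")
    case True
    then show ?thesis
      using increasing_indexing_agree_below[OF shift[OF f, of i] shift[OF g, of i], of "k - i"] eq by simp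
  next
    case False
    note f' = increasing_indexingD[OF f] and g' = increasing_indexingD[OF g]
    have "f m = g m" if "i \<le> m" for m using that
    proof (induction m rule: int_ge_induct)
      case base show ?case by (fact eq)
    next
      case (step m)
      obtain a b where a: "f (m + 1) = g a" and b: "g (m + 1) = f b" using f' g' by metis
      have "g m < g a" using a step.IH strict_mono_less[OF f'(1), of m "m + 1"] by simp
      then have "m + 1 \<le> a" using g'(1) by (simp add: strict_mono_less)
      moreover have "f m < f b" using b step.IH strict_mono_less[OF g'(1), of m "m + 1"] by simp
      then have "m + 1 \<le> b" using f'(1) by (simp add: strict_mono_less)
      ultimately show ?case using a b strict_mono_less_eq[OF f'(1), of "m + 1" b]
          strict_mono_less_eq[OF g'(1), of "m + 1" a] by simp
    qed
    then show ?thesis using False by simp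
  qed
qed

section \<open>Switch points between two disjoint sets\<close>

definition switch_points :: "int set \<Rightarrow> int set \<Rightarrow> int set" where
  "switch_points A B = {p\<in>A. \<exists>b\<in>B. b < p \<and> {b<..<p} \<inter> A = {}}"

text \<open>A point of \<open>B\<close> lies between \<open>p\<close> and its predecessor in
  \<open>A\<close> exactly when some earlier \<open>b\<close> has no point of \<open>A\<close>
  between itself and \<open>p\<close>. Disjointness gives the strict inequality
  \<open>a (j - 1) < b\<close>.\<close>

lemma switch_points_indexed:
  assumes A: "biinfinite A" and disj: "A \<inter> B = {}"
  shows "{a j | a j. increasing_indexing A a \<and> (\<exists>b\<in>B. a (j - 1) < b \<and> b < a j)} = switch_points A B"
    (is "?L = _")
proof (intro equalityI subsetI)
  fix x assume "x \<in> ?L"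
  then obtain a j b where a: "increasing_indexing A a" and x: "x = a j"
    and b: "b \<in> B" "a (j - 1) < b" "b < a j" by auto
  have "{b<..<x} \<inter> A = {}" using increasing_indexing_gap[OF a, of _ "j - 1"] b x by fastforce
  then show "x \<in> switch_points A B"
    using b x increasing_indexingD(2)[OF a] by (auto simp: switch_points_def)
next
  fix x assume "x \<in> switch_points A B"
  then obtain b where b: "x \<in> A" "b \<in> B" "b < x" "{b<..<x} \<inter> A = {}"
    by (auto simp: switch_points_def)
  obtain a where a: "increasing_indexing A a" "a 0 = x" using increasing_indexing_ex[OF A b(1)] .
  have 1: "a (0 - 1) \<in> A" "a (0 - 1) < x"
    using increasing_indexingD[OF a(1)] a(2) by (auto simp: strict_mono_less simp flip: a(2))
  then have "a (0 - 1) \<noteq> b" "\<not> b < a (0 - 1)" using b disj by auto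
  then have "a (0 - 1) < b" by simp
  then show "x \<in> ?L" using a b by blast
qed

locale biinfinite_pair =
  fixes A B :: "int set"
  assumes inf_A: "biinfinite A" and inf_B: "biinfinite B" and disj: "A \<inter> B = {}"
begin

lemma biinfinite_pair_swap: "biinfinite_pair B A"
  using inf_A inf_B disj by unfold_locales auto

text \<open>The first point of \<open>A\<close> after any point of \<open>B\<close> is a switch
  point. On the left, starting from a \<open>b\<close> below some \<open>a < n\<close> keeps this
  point below \<open>n\<close>.\<close>

lemma biinfinite_switch_points: "biinfinite (switch_points A B)"
  unfolding biinfinite_def
proof (intro allI conjI)
  fix n
  obtain a where a: "a \<in> A" "a < n" using inf_A by (auto simp: biinfinite_def)
  obtain b where b: "b \<in> B" "b < a" using inf_B by (auto simp: biinfinite_def)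
  obtain s where s: "s \<in> A" "b < s" "\<And>t. t \<in> A \<Longrightarrow> b < t \<Longrightarrow> s \<le> t" by (rule biinfinite_next[OF inf_A, where n = b]) blast
  have "s \<in> switch_points A B" using s b by (force simp: switch_points_def)
  moreover have "s < n" using s(3)[of a] a b by simp
  ultimately show "\<exists>s\<in>switch_points A B. s < n" by blast
next
  fix n
  obtain b where b: "b \<in> B" "n < b" using inf_B by (auto simp: biinfinite_def)
  obtain s where s: "s \<in> A" "b < s" "\<And>t. t \<in> A \<Longrightarrow> b < t \<Longrightarrow> s \<le> t" by (rule biinfinite_next[OF inf_A, where n = b]) blast
  have "s \<in> switch_points A B" using s b by (force simp: switch_points_def)
  then show "\<exists>s\<in>switch_points A B. n < s" using b(2) s(2) by (intro bexI[of _ s]) simp_all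
qed

lemma switch_points_subset: "switch_points A B \<subseteq> A"
  by (auto simp: switch_points_def)

lemma switch_points_between:
  assumes "p \<in> A" "p' \<in> switch_points A B" "p < p'"
  obtains b where "b \<in> B" "p < b" "b < p'"
proof -
  obtain b where b: "b \<in> B" "b < p'" "{b<..<p'} \<inter> A = {}" using assms(2) by (auto simp: switch_points_def)
  have "p \<noteq> b" "\<not> b < p" using assms b disj by auto
  then show thesis using that[of b] b by simp
qed

lemma next_is_switch_point:
  assumes "p \<in> A" "b \<in> B" "p < b" "\<And>t. t \<in> B \<Longrightarrow> p < t \<Longrightarrow> b \<le> t"
  shows "b \<in> switch_points B A"
  using assms by (force simp: switch_points_def)

lemma switch_points_alternate:
  assumes "p \<in> A" "p' \<in> switch_points A B" "p < p'"
  obtains q where "q \<in> switch_points B A" "p < q" "q < p'"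
proof -
  obtain b where b: "b \<in> B" "p < b" "b < p'" using switch_points_between[OF assms] .
  obtain q where q: "q \<in> B" "p < q" "\<And>t. t \<in> B \<Longrightarrow> p < t \<Longrightarrow> q \<le> t" by (rule biinfinite_next[OF inf_B, where n = p]) blast
  have "q \<in> switch_points B A" using next_is_switch_point[OF assms(1) q] .
  then show thesis using that[of q] q b by force
qed

interpretation sw: biinfinite_pair B A by (rule biinfinite_pair_swap)

text \<open>Choose \<open>q k\<close> in the gap between \<open>p k\<close> and
  \<open>p (k + 1)\<close>. Nothing is missed: two points of the second kind in one gap would, by
  alternation with the roles exchanged, enclose a further point of the first kind.\<close>

lemma interlacing_indexing_ex:
  assumes p: "increasing_indexing (switch_points A B) p"
  obtains q where "increasing_indexing (switch_points B A) q" "\<And>k. p k < q k \<and> q k < p (k + 1)"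
proof -
  note p' = increasing_indexingD[OF p]
  have pA: "p k \<in> A" for k using p'(2) switch_points_subset by blast
  have "\<exists>q. q \<in> switch_points B A \<and> p k < q \<and> q < p (k + 1)" for k
    using switch_points_alternate[OF pA[of k] p'(2)[of "k + 1"]] strict_mono_less[OF p'(1), of k "k + 1"]
    by auto
  then obtain q where q: "\<And>k. q k \<in> switch_points B A" "\<And>k. p k < q k" "\<And>k. q k < p (k + 1)"
    by metis
  have "q k < q (k + 1)" for k using q(2)[of "k + 1"] q(3)[of k] by simp
  then have sm: "strict_mono q" by (rule strict_mono_int)
  have "range q = switch_points B A"
  proof
    show "range q \<subseteq> switch_points B A" using q(1) by auto
    show "switch_points B A \<subseteq> range q"
    proof
      fix x assume x: "x \<in> switch_points B A"
      obtain k where k: "p k \<le> x" "x < p (k + 1)" using strict_mono_int_bracket[OF p'(1)] .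
      have "x = q k"
      proof (rule ccontr)
        assume ne: "x \<noteq> q k"
        define lo hi where "lo = min x (q k)" and "hi = max x (q k)"
        have "lo \<in> switch_points B A" "hi \<in> switch_points B A" "lo < hi" "p k \<le> lo" "hi < p (k + 1)"
          using ne x q[of k] k by (auto simp: lo_def hi_def min_def max_def)
        moreover from this have "lo \<in> B" using sw.switch_points_subset by blast
        ultimately obtain y where "y \<in> switch_points A B" "lo < y" "y < hi"
          using sw.switch_points_alternate by metis
        then show False
          using increasing_indexing_gap[OF p, of y k] \<open>p k \<le> lo\<close> \<open>hi < p (k + 1)\<close> by simp
      qed
      then show "x \<in> range q" by simp
    qed
  qed
  then show thesis using that[of q] sm q by (simp add: increasing_indexing_def)
qed

end

text \<open>No point of \<open>A\<close> lies in \<open>{q<..<x}\<close>, so the last switch point of each kind up to \<open>x\<close> is \<open>x\<close>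
  resp. at most \<open>q\<close>: the points of \<open>B\<close> in \<open>{q<..<x}\<close> are irrelevant.\<close>

lemma switch_points_agree_below:
  assumes "x \<in> A" "x \<in> A'" "q \<in> B" "q \<in> B'" "q < x" "x \<notin> B" "x \<notin> B'"
    and gap: "{q<..<x} \<inter> A = {}" and A: "A \<inter> {..x} = A' \<inter> {..x}" and B: "B \<inter> {..q} = B' \<inter> {..q}"
    and disj: "A \<inter> B = {}" "A' \<inter> B' = {}"
  shows "switch_points A B \<inter> {..x} = switch_points A' B' \<inter> {..x}"
    and "switch_points B A \<inter> {..x} = switch_points B' A' \<inter> {..x}"
proof -
  \<comment> \<open>Stated for generic sets so that both inclusions are instances. \<open>B\<close>
    and \<open>B'\<close> may differ strictly between \<open>q\<close> and \<open>x\<close>, but a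
    point there is separated by \<open>q\<close> from every earlier point of \<open>A\<close>, so it
    is no switch point.\<close>
  have *: "switch_points A B \<inter> {..x} \<subseteq> switch_points A' B' \<inter> {..x} \<and>
      switch_points B A \<inter> {..x} \<subseteq> switch_points B' A' \<inter> {..x}"
    if h: "x \<in> A" "x \<in> A'" "q \<in> B" "q \<in> B'" "q < x" "x \<notin> B" "{q<..<x} \<inter> A = {}"
      "\<And>y. y \<le> x \<Longrightarrow> y \<in> A \<longleftrightarrow> y \<in> A'" "\<And>y. y \<le> q \<Longrightarrow> y \<in> B \<longleftrightarrow> y \<in> B'" "A \<inter> B = {}" for A A' B B'
  proof (intro conjI subsetI)
    fix p assume "p \<in> switch_points A B \<inter> {..x}"
    then obtain b where b: "p \<in> A" "p \<le> x" "b \<in> B" "b < p" "{b<..<p} \<inter> A = {}"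
      by (auto simp: switch_points_def)
    have pA': "p \<in> A'" using h(8) b by simp
    show "p \<in> switch_points A' B' \<inter> {..x}"
    proof (cases "p < q")
      case True
      then have "b \<in> B'" "{b<..<p} \<inter> A' = {}" using b h(5) h(8) h(9) by force+
      then show ?thesis using b pA' by (auto simp: switch_points_def)
    next
      case False
      then have "p = x" using b h(3,7,10) by (cases "p = q") force+
      moreover have "{q<..<x} \<inter> A' = {}" using h(7,8) by force
      ultimately show ?thesis using h(4,5) pA' by (auto simp: switch_points_def)
    qed
  next
    fix y assume "y \<in> switch_points B A \<inter> {..x}"
    then obtain a where a: "y \<in> B" "y \<le> x" "a \<in> A" "a < y" "{a<..<y} \<inter> B = {}"
      by (auto simp: switch_points_def)
    have "a < x" using a by simp
    then have "a \<le> q" using a(3) h(7) by force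
    then have "a < q" using a(3) h(3,10) by (cases "a = q") auto
    then have yq: "y \<le> q" using a(5) h(3) by force
    then have "y \<in> B'" "a \<in> A'" "{a<..<y} \<inter> B' = {}" using a h(8,9) by force+
    then show "y \<in> switch_points B' A' \<inter> {..x}" using a by (auto simp: switch_points_def)
  qed
  have gap': "{q<..<x} \<inter> A' = {}" using gap A by force
  have A': "y \<in> A \<longleftrightarrow> y \<in> A'" if "y \<le> x" for y using that A by blast
  have B': "y \<in> B \<longleftrightarrow> y \<in> B'" if "y \<le> q" for y using that B by blast
  have 1: "switch_points A B \<inter> {..x} \<subseteq> switch_points A' B' \<inter> {..x} \<and>
      switch_points B A \<inter> {..x} \<subseteq> switch_points B' A' \<inter> {..x}"
    by (rule *) (use assms A' B' in auto)
  have 2: "switch_points A' B' \<inter> {..x} \<subseteq> switch_points A B \<inter> {..x} \<and>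
      switch_points B' A' \<inter> {..x} \<subseteq> switch_points B A \<inter> {..x}"
    by (rule *) (use assms gap' A' B' in auto)
  show "switch_points A B \<inter> {..x} = switch_points A' B' \<inter> {..x}"
    and "switch_points B A \<inter> {..x} = switch_points B' A' \<inter> {..x}"
    using 1 2 by auto
qed

section \<open>Cut points of a configuration\<close>

text \<open>Heights are integers: if all later ones are smaller, they are smaller by at least 1, and
  strictness survives the supremum.\<close>

lemma A_set_iff: "a \<in> A_set \<eta> \<longleftrightarrow> (\<forall>r>a. height \<eta> r < height \<eta> a)"
proof
  assume "a \<in> A_set \<eta>"
  then have *: "(SUP r\<in>{a<..}. ereal (real_of_int (height \<eta> r))) < ereal (real_of_int (height \<eta> a))"
    by (simp add: A_set_def)
  show "\<forall>r>a. height \<eta> r < height \<eta> a"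
  proof (intro allI impI)
    fix r assume "a < r"
    then have "ereal (real_of_int (height \<eta> r)) \<le> (SUP r\<in>{a<..}. ereal (real_of_int (height \<eta> r)))"
      by (intro SUP_upper) simp
    also note *
    finally show "height \<eta> r < height \<eta> a" by simp
  qed
next
  assume *: "\<forall>r>a. height \<eta> r < height \<eta> a"
  have "(SUP r\<in>{a<..}. ereal (real_of_int (height \<eta> r))) \<le> ereal (real_of_int (height \<eta> a - 1))"
    using * by (intro SUP_least) force
  also have "\<dots> < ereal (real_of_int (height \<eta> a))" by simp
  finally show "a \<in> A_set \<eta>" by (simp add: A_set_def)
qed

text \<open>Multiplying \<open>h^*\<close> by 3 makes it integral; distinct values of
  \<open>h^*\<close> thus differ by at least 1/3, which keeps the infimum strict.\<close>

lemma B_set_iff: "b \<in> B_set \<eta> \<longleftrightarrow> (\<forall>r>b. 3 * height \<eta> b + b < 3 * height \<eta> r + r)"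
proof
  assume "b \<in> B_set \<eta>"
  then have *: "ereal (height_star \<eta> b) < (INF r\<in>{b<..}. ereal (height_star \<eta> r))"
    by (simp add: B_set_def)
  show "\<forall>r>b. 3 * height \<eta> b + b < 3 * height \<eta> r + r"
  proof (intro allI impI)
    fix r assume "b < r"
    note *
    also have "(INF r\<in>{b<..}. ereal (height_star \<eta> r)) \<le> ereal (height_star \<eta> r)"
      using \<open>b < r\<close> by (intro INF_lower) simp
    finally show "3 * height \<eta> b + b < 3 * height \<eta> r + r" by (simp add: height_star_def)
  qed
next
  assume *: "\<forall>r>b. 3 * height \<eta> b + b < 3 * height \<eta> r + r"
  have "ereal (height_star \<eta> b) < ereal (height_star \<eta> b + 1 / 3)" by simp
  also have "\<dots> \<le> (INF r\<in>{b<..}. ereal (height_star \<eta> r))"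
  proof (intro INF_greatest)
    fix r assume "r \<in> {b<..}"
    then have "3 * height \<eta> b + b + 1 \<le> 3 * height \<eta> r + r" using * by force
    then show "ereal (height_star \<eta> b + 1 / 3) \<le> ereal (height_star \<eta> r)"
      unfolding height_star_def ereal_less_eq by linarith
  qed
  finally show "b \<in> B_set \<eta>" by (simp add: B_set_def)
qed

text \<open>Right after a point of \<open>A\<close> the path steps down, which lowers
  \<open>h^*\<close> by 2/3; this cannot happen after a point of \<open>B\<close>.\<close>

lemma A_B_disjoint: "A_set \<eta> \<inter> B_set \<eta> = {}"
proof -
  have False if "x \<in> A_set \<eta>" "x \<in> B_set \<eta>" for x
  proof -
    have "height \<eta> (x + 1) < height \<eta> x" using that by (simp add: A_set_iff)
    moreover have "3 * height \<eta> x + x < 3 * height \<eta> (x + 1) + (x + 1)"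
      using that(2) unfolding B_set_iff by (metis less_add_one)
    ultimately show False by linarith
  qed
  then show ?thesis by blast
qed

section \<open>Configurations with unbounded cut sets and their indexed points\<close>

definition good_config :: "config \<Rightarrow> bool" where
  "good_config \<eta> \<longleftrightarrow> biinfinite (A_set \<eta>) \<and> biinfinite (B_set \<eta>)"

lemma good_config_pair: "good_config \<eta> \<longleftrightarrow> biinfinite_pair (A_set \<eta>) (B_set \<eta>)"
  using A_B_disjoint by (auto simp: good_config_def biinfinite_pair_def)

lemma P_set_eq: "good_config \<eta> \<Longrightarrow> P_set \<eta> = switch_points (A_set \<eta>) (B_set \<eta>)"
  unfolding P_set_def using switch_points_indexed A_B_disjoint by (simp add: good_config_def)

lemma Q_set_eq: "good_config \<eta> \<Longrightarrow> Q_set \<eta> = switch_points (B_set \<eta>) (A_set \<eta>)"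
  unfolding Q_set_def using switch_points_indexed[of "B_set \<eta>" "A_set \<eta>"] A_B_disjoint[of \<eta>]
  by (simp add: good_config_def Int_commute)

text \<open>\<open>V_set\<close> with membership in \<open>X_set\<close> weakened to the
  unboundedness that it implies. This event does not mention \<rho>; for 1/2 < \<rho> < 2/3 it
  differs from \<open>V_set\<close> by a null set.\<close>

definition V_core :: "config set" where
  "V_core = {\<eta>. good_config \<eta> \<and> 0 \<in> P_set \<eta>}"

lemma V_coreD: "\<eta> \<in> V_core \<Longrightarrow> good_config \<eta>" "\<eta> \<in> V_core \<Longrightarrow> 0 \<in> P_set \<eta>"
  by (auto simp: V_core_def)

lemma biinfinite_P_set: "good_config \<eta> \<Longrightarrow> biinfinite (P_set \<eta>)"
  using biinfinite_pair.biinfinite_switch_points by (simp add: P_set_eq good_config_pair)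

lemma P_subset_A: "good_config \<eta> \<Longrightarrow> P_set \<eta> \<subseteq> A_set \<eta>"
  by (auto simp: P_set_eq switch_points_def)

lemma Q_subset_B: "good_config \<eta> \<Longrightarrow> Q_set \<eta> \<subseteq> B_set \<eta>"
  by (auto simp: Q_set_eq switch_points_def)

lemma p_point_props:
  assumes "\<eta> \<in> V_core"
  shows "increasing_indexing (P_set \<eta>) (p_point \<eta>)" "p_point \<eta> 0 = 0"
proof -
  have "\<exists>!p. increasing_indexing (P_set \<eta>) p \<and> p 0 = 0"
  proof (rule ex_ex1I)
    show "\<exists>p. increasing_indexing (P_set \<eta>) p \<and> p 0 = 0"
      using increasing_indexing_ex[OF biinfinite_P_set[OF V_coreD(1)[OF assms]] V_coreD(2)[OF assms]] by blast
    show "p = p'" if "increasing_indexing (P_set \<eta>) p \<and> p 0 = 0" "increasing_indexing (P_set \<eta>) p' \<and> p' 0 = 0"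
      for p p' using that increasing_indexing_unique[of "P_set \<eta>" p p' 0] by simp
  qed
  from theI'[OF this] show "increasing_indexing (P_set \<eta>) (p_point \<eta>)" "p_point \<eta> 0 = 0"
    by (auto simp: p_point_def)
qed

lemma p_point_eqI:
  assumes "\<eta> \<in> V_core" "increasing_indexing (P_set \<eta>) p" "p 0 = 0"
  shows "p_point \<eta> = p"
  using increasing_indexing_unique[OF p_point_props(1)[OF assms(1)] assms(2), of 0] p_point_props(2)[OF assms(1)]
    assms(3) by simp

text \<open>Two indexings of \<open>Q_set\<close> satisfy \<open>q 0 = q' m\<close> for some
  \<open>m\<close>; lying between consecutive points \<open>p_k\<close> forces \<open>m = 0\<close>,
  which justifies the definite description.\<close>

lemma q_point_props:
  assumes "\<eta> \<in> V_core"
  shows "increasing_indexing (Q_set \<eta>) (q_point \<eta>)"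
    "p_point \<eta> k < q_point \<eta> k" "q_point \<eta> k < p_point \<eta> (k + 1)"
proof -
  let ?R = "\<lambda>q. increasing_indexing (Q_set \<eta>) q \<and> (\<forall>k. p_point \<eta> k < q k \<and> q k < p_point \<eta> (k + 1))"
  note g = V_coreD(1)[OF assms]
  note p = p_point_props(1)[OF assms]
  have ex: "\<exists>q. ?R q"
    by (rule biinfinite_pair.interlacing_indexing_ex[of "A_set \<eta>" "B_set \<eta>" "p_point \<eta>"])
      (use g p in \<open>auto simp: P_set_eq Q_set_eq good_config_pair\<close>)
  have uq: "q = q'" if "?R q" "?R q'" for q q'
  proof -
    have "increasing_indexing (Q_set \<eta>) q" "increasing_indexing (Q_set \<eta>) q'" using that by simp_all
    then obtain m where m: "q 0 = q' m" using increasing_indexingD(2,3) by metis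
    have "p_point \<eta> 0 < p_point \<eta> (m + 1)" "p_point \<eta> m < p_point \<eta> (0 + 1)"
      using m that(1)[THEN conjunct2, THEN spec, of 0] that(2)[THEN conjunct2, THEN spec, of m] by simp_all
    then have "0 < m + 1" "m < 0 + 1"
      using strict_mono_less[OF increasing_indexingD(1)[OF p]] by blast+
    then have "m = 0" by simp
    then show ?thesis using m that increasing_indexing_unique[of "Q_set \<eta>" q q' 0] by simp
  qed
  have "?R (q_point \<eta>)" unfolding q_point_def by (rule theI'[where P = ?R]) (use ex uq in blast)
  then show "increasing_indexing (Q_set \<eta>) (q_point \<eta>)"
    "p_point \<eta> k < q_point \<eta> k" "q_point \<eta> k < p_point \<eta> (k + 1)" by auto
qed

lemma q_point_eqI:
  assumes "\<eta> \<in> V_core" "x \<in> Q_set \<eta>" "p_point \<eta> k < x" "x < p_point \<eta> (k + 1)"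
  shows "q_point \<eta> k = x"
proof -
  obtain m where m: "x = q_point \<eta> m"
    using increasing_indexingD(3)[OF q_point_props(1)[OF assms(1)] assms(2)] by blast
  note sm = strict_mono_less[OF increasing_indexingD(1)[OF p_point_props(1)[OF assms(1)]]]
  have "p_point \<eta> k < p_point \<eta> (m + 1)" "p_point \<eta> m < p_point \<eta> (k + 1)"
    using m assms(3,4) q_point_props(2,3)[OF assms(1), of m] by linarith+
  then have "k < m + 1" "m < k + 1" using sm by blast+
  then show ?thesis using m by simp
qed

lemma p_point_eqI':
  assumes "\<eta> \<in> V_core" "x \<in> P_set \<eta>" "q_point \<eta> (k - 1) < x" "x < q_point \<eta> k"
  shows "p_point \<eta> k = x"
proof -
  obtain m where m: "x = p_point \<eta> m"
    using increasing_indexingD(3)[OF p_point_props(1)[OF assms(1)] assms(2)] by blast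
  note sm = strict_mono_less[OF increasing_indexingD(1)[OF q_point_props(1)[OF assms(1)]]]
  have "q_point \<eta> (k - 1) < q_point \<eta> m" "q_point \<eta> (m - 1) < q_point \<eta> k"
    using m assms(3,4) q_point_props(2)[OF assms(1), of m] q_point_props(3)[OF assms(1), of "m - 1"] by simp_all
  then have "k - 1 < m" "m - 1 < k" using sm by blast+
  then have "k = m" by simp
  then show ?thesis using m by simp
qed

lemma p_point_in: "\<eta> \<in> V_core \<Longrightarrow> p_point \<eta> k \<in> P_set \<eta>"
  by (rule increasing_indexingD(2)[OF p_point_props(1)])

lemma q_point_in: "\<eta> \<in> V_core \<Longrightarrow> q_point \<eta> k \<in> Q_set \<eta>"
  by (rule increasing_indexingD(2)[OF q_point_props(1)])

text \<open>Determines \<open>q_k\<close> from \<open>p_k\<close> and the points of \<open>B\<close>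
  to its right, without counting indices. In this form the value transfers to another configuration
  with the same \<open>p_k\<close> and the same \<open>B\<close> beyond it.\<close>

lemma q_point_first_B:
  assumes "\<eta> \<in> V_core" "b \<in> B_set \<eta>" "p_point \<eta> k < b" "\<And>t. t \<in> B_set \<eta> \<Longrightarrow> p_point \<eta> k < t \<Longrightarrow> b \<le> t"
  shows "q_point \<eta> k = b"
proof (rule q_point_eqI[OF assms(1)])
  note g = V_coreD(1)[OF assms(1)]
  have "p_point \<eta> k \<in> A_set \<eta>" using p_point_in[OF assms(1)] P_subset_A[OF g] by blast
  then show "b \<in> Q_set \<eta>" using biinfinite_pair.next_is_switch_point[of "A_set \<eta>" "B_set \<eta>"] assms g
    by (simp add: Q_set_eq good_config_pair)
  show "p_point \<eta> k < b" by fact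
  have "q_point \<eta> k \<in> B_set \<eta>" using q_point_in[OF assms(1)] Q_subset_B[OF g] by blast
  then have "b \<le> q_point \<eta> k" using assms(4) q_point_props(2)[OF assms(1)] by blast
  then show "b < p_point \<eta> (k + 1)" using q_point_props(3)[OF assms(1), of k] by simp
qed

lemma p_point_first_A:
  assumes "\<eta> \<in> V_core" "a \<in> A_set \<eta>" "q_point \<eta> (k - 1) < a" "\<And>t. t \<in> A_set \<eta> \<Longrightarrow> q_point \<eta> (k - 1) < t \<Longrightarrow> a \<le> t"
  shows "p_point \<eta> k = a"
proof (rule p_point_eqI'[OF assms(1)])
  note g = V_coreD(1)[OF assms(1)]
  have "q_point \<eta> (k - 1) \<in> B_set \<eta>" using q_point_in[OF assms(1)] Q_subset_B[OF g] by blast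
  then show "a \<in> P_set \<eta>"
    using biinfinite_pair.next_is_switch_point[OF biinfinite_pair.biinfinite_pair_swap, of "A_set \<eta>" "B_set \<eta>"] assms g
    by (simp add: P_set_eq good_config_pair)
  show "q_point \<eta> (k - 1) < a" by fact
  have "p_point \<eta> k \<in> A_set \<eta>" using p_point_in[OF assms(1)] P_subset_A[OF g] by blast
  moreover have "q_point \<eta> (k - 1) < p_point \<eta> k" using q_point_props(3)[OF assms(1), of "k - 1"] by simp
  ultimately have "a \<le> p_point \<eta> k" using assms(4) by blast
  then show "a < q_point \<eta> k" using q_point_props(2)[OF assms(1), of k] by simp
qed

lemma q_point_least:
  assumes "\<eta> \<in> V_core" "t \<in> B_set \<eta>" "p_point \<eta> k < t"
  shows "q_point \<eta> k \<le> t"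
proof -
  have "biinfinite (B_set \<eta>)" using V_coreD(1)[OF assms(1)] by (simp add: good_config_def)
  then obtain s where s: "s \<in> B_set \<eta>" "p_point \<eta> k < s"
      "\<And>t. t \<in> B_set \<eta> \<Longrightarrow> p_point \<eta> k < t \<Longrightarrow> s \<le> t"
    by (rule biinfinite_next[where n = "p_point \<eta> k"]) blast
  then show ?thesis using q_point_first_B[OF assms(1) s] assms by simp
qed

lemma p_point_least:
  assumes "\<eta> \<in> V_core" "t \<in> A_set \<eta>" "q_point \<eta> (k - 1) < t"
  shows "p_point \<eta> k \<le> t"
proof -
  have "biinfinite (A_set \<eta>)" using V_coreD(1)[OF assms(1)] by (simp add: good_config_def)
  then obtain s where s: "s \<in> A_set \<eta>" "q_point \<eta> (k - 1) < s"
      "\<And>t. t \<in> A_set \<eta> \<Longrightarrow> q_point \<eta> (k - 1) < t \<Longrightarrow> s \<le> t"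
    by (rule biinfinite_next[where n = "q_point \<eta> (k - 1)"]) blast
  then show ?thesis using p_point_first_A[OF assms(1) s] assms by simp
qed

section \<open>Translation of configurations\<close>

definition shift_config :: "int \<Rightarrow> config \<Rightarrow> config" where
  "shift_config x \<eta> = (\<lambda>i. \<eta> (i + x))"

lemma shift_config_inverse: "shift_config (- x) (shift_config x \<eta>) = \<eta>"
  by (simp add: shift_config_def)

lemma height_shift: "height (shift_config x \<eta>) k = height \<eta> (k + x) - height \<eta> x"
proof -
  have "(\<lambda>k. height \<eta> (k + x) - height \<eta> x) = height (shift_config x \<eta>)"
  proof (rule height_unique)
    fix k
    show "height \<eta> (k + x) - height \<eta> x - (height \<eta> (k - 1 + x) - height \<eta> x) =
        (- 1) ^ of_bool (shift_config x \<eta> k)"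
      using height_step[of \<eta> "k + x"] by (simp add: shift_config_def algebra_simps)
  qed simp
  then show ?thesis by metis
qed

lemma all_greater_shift: "(\<forall>r>k + x. Pr r) \<longleftrightarrow> (\<forall>r>k. Pr (r + x))" for k x :: int
proof (intro iffI allI impI)
  fix r assume "\<forall>r>k. Pr (r + x)" "k + x < r"
  then have "Pr (r - x + x)" by (metis less_diff_eq)
  then show "Pr r" by simp
qed simp

lemma A_set_shift: "k \<in> A_set (shift_config x \<eta>) \<longleftrightarrow> k + x \<in> A_set \<eta>"
  by (simp add: A_set_iff height_shift all_greater_shift)

lemma B_set_shift: "k \<in> B_set (shift_config x \<eta>) \<longleftrightarrow> k + x \<in> B_set \<eta>"
  by (simp add: B_set_iff height_shift all_greater_shift algebra_simps)

lemma Bex_shift: "(\<exists>s. s + x \<in> S \<and> Pr (s + x)) \<longleftrightarrow> (\<exists>s\<in>S. Pr s)" for x :: int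
proof
  assume "\<exists>s\<in>S. Pr s"
  then obtain s where "s \<in> S" "Pr s" by blast
  then show "\<exists>s. s + x \<in> S \<and> Pr (s + x)" by (intro exI[of _ "s - x"]) simp
qed blast

lemma biinfinite_shift: "biinfinite {k. k + x \<in> S} \<longleftrightarrow> biinfinite S"
proof -
  have "(\<exists>s. s + x \<in> S \<and> s < n) \<longleftrightarrow> (\<exists>s\<in>S. s < n + x)"
    and "(\<exists>s. s + x \<in> S \<and> n < s) \<longleftrightarrow> (\<exists>s\<in>S. n + x < s)" for n
    using Bex_shift[of x S "\<lambda>s. s < n + x"] Bex_shift[of x S "\<lambda>s. n + x < s"] by simp_all
  then have "biinfinite {k. k + x \<in> S} \<longleftrightarrow> (\<forall>n. (\<exists>s\<in>S. s < n + x) \<and> (\<exists>s\<in>S. n + x < s))"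
    by (simp add: biinfinite_def Bex_def)
  also have "\<dots> \<longleftrightarrow> biinfinite S"
    unfolding biinfinite_def by (metis (no_types) diff_add_cancel)
  finally show ?thesis .
qed

lemma switch_points_shift:
  "k \<in> switch_points {k. k + x \<in> A} {k. k + x \<in> B} \<longleftrightarrow> k + x \<in> switch_points A B"
proof -
  have "{b<..<k} \<inter> {k. k + x \<in> A} = {} \<longleftrightarrow> {b + x<..<k + x} \<inter> A = {}" for b
    using Bex_shift[of x A "\<lambda>s. b + x < s \<and> s < k + x"] by (auto simp: disjoint_iff)
  then show ?thesis
    using Bex_shift[of x B "\<lambda>b. b < k + x \<and> {b<..<k + x} \<inter> A = {}"]
    by (simp add: switch_points_def Bex_def)
qed

lemma AB_set_shift:
  "A_set (shift_config x \<eta>) = {k. k + x \<in> A_set \<eta>}" "B_set (shift_config x \<eta>) = {k. k + x \<in> B_set \<eta>}"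
  by (auto simp: A_set_shift B_set_shift)

lemma good_config_shift: "good_config (shift_config x \<eta>) \<longleftrightarrow> good_config \<eta>"
  by (simp add: good_config_def AB_set_shift biinfinite_shift)

lemma P_set_shift: "good_config \<eta> \<Longrightarrow> k \<in> P_set (shift_config x \<eta>) \<longleftrightarrow> k + x \<in> P_set \<eta>"
  using good_config_shift[of x \<eta>] by (simp add: P_set_eq AB_set_shift switch_points_shift)

lemma Q_set_shift: "good_config \<eta> \<Longrightarrow> k \<in> Q_set (shift_config x \<eta>) \<longleftrightarrow> k + x \<in> Q_set \<eta>"
  using good_config_shift[of x \<eta>] by (simp add: Q_set_eq AB_set_shift switch_points_shift)

text \<open>\<open>Y\<close> consists of differences and so does not notice the new origin. Its
  index moves by an even number, so the two kinds of increments keep their roles.\<close>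

lemma V_core_shift:
  assumes "\<eta> \<in> V_core" and x: "x = p_point \<eta> k"
  shows "shift_config x \<eta> \<in> V_core"
    and "p_point (shift_config x \<eta>) i = p_point \<eta> (i + k) - x"
    and "q_point (shift_config x \<eta>) i = q_point \<eta> (i + k) - x"
    and "Y_proc i (shift_config x \<eta>) = Y_proc (i + 2 * k) \<eta>"
proof -
  note g = V_coreD(1)[OF assms(1)]
  show V: "shift_config x \<eta> \<in> V_core"
    using p_point_in[OF assms(1), of k] g by (simp add: V_core_def good_config_shift P_set_shift x)
  note p = p_point_props[OF assms(1)]
  have "strict_mono (\<lambda>i. p_point \<eta> (i + k) - x)"
    using increasing_indexingD(1)[OF p(1)] by (simp add: strict_mono_def)
  moreover have "range (\<lambda>i. p_point \<eta> (i + k) - x) = P_set (shift_config x \<eta>)"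
  proof (intro equalityI subsetI)
    fix y assume "y \<in> range (\<lambda>i. p_point \<eta> (i + k) - x)"
    then show "y \<in> P_set (shift_config x \<eta>)"
      using p_point_in[OF assms(1)] g by (auto simp: P_set_shift)
  next
    fix y assume "y \<in> P_set (shift_config x \<eta>)"
    then obtain m where "y + x = p_point \<eta> m"
      using increasing_indexingD(3)[OF p(1)] g by (auto simp: P_set_shift)
    then show "y \<in> range (\<lambda>i. p_point \<eta> (i + k) - x)"
      by (intro image_eqI[where x = "m - k"]) (auto simp: algebra_simps)
  qed
  ultimately have pe: "p_point (shift_config x \<eta>) = (\<lambda>i. p_point \<eta> (i + k) - x)"
    by (intro p_point_eqI[OF V]) (simp_all add: increasing_indexing_def x)
  then have pi: "p_point (shift_config x \<eta>) i = p_point \<eta> (i + k) - x" for i by simp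
  have qi: "q_point (shift_config x \<eta>) i = q_point \<eta> (i + k) - x" for i
  proof (rule q_point_eqI[OF V])
    show "q_point \<eta> (i + k) - x \<in> Q_set (shift_config x \<eta>)"
      using q_point_in[OF assms(1)] g by (simp add: Q_set_shift)
    show "p_point (shift_config x \<eta>) i < q_point \<eta> (i + k) - x"
      "q_point \<eta> (i + k) - x < p_point (shift_config x \<eta>) (i + 1)"
      using q_point_props(2,3)[OF assms(1), of "i + k"] by (simp_all add: pi algebra_simps)
  qed
  show "p_point (shift_config x \<eta>) i = p_point \<eta> (i + k) - x"
    and "q_point (shift_config x \<eta>) i = q_point \<eta> (i + k) - x" by (rule pi qi)+
  have div: "(i + 2 * k) div 2 = i div 2 + k" by simp
  have sub: "i div 2 + k - 1 = i div 2 - 1 + k" by simp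
  then show "Y_proc i (shift_config x \<eta>) = Y_proc (i + 2 * k) \<eta>"
    by (simp add: Y_proc_def Let_def div sub pi qi height_shift)
qed

section \<open>Exchanging futures at a cut point\<close>

definition glue :: "int \<Rightarrow> config \<Rightarrow> config \<Rightarrow> config" where
  "glue d \<eta> \<zeta> = (\<lambda>i. if i \<le> d then \<eta> i else \<zeta> i)"

text \<open>Heights are normalised at 0, so the coordinates up to \<open>d\<close> determine the
  heights there only if 0 is one of these times; hence \<open>0 \<le> d\<close>.\<close>

lemma height_glue_below:
  assumes "0 \<le> d" "k \<le> d"
  shows "height (glue d \<eta> \<zeta>) k = height \<eta> k"
proof -
  have "(\<Sum>i\<in>S. (-1) ^ of_bool (glue d \<eta> \<zeta> i)) = (\<Sum>i\<in>S. (-1::int) ^ of_bool (\<eta> i))"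
    if "S \<subseteq> {..d}" for S
    using that by (intro sum.cong) (auto simp: glue_def)
  from this[of "{0<..k}"] this[of "{k<..0}"] show ?thesis using assms by (force simp: height_def)
qed

lemma height_glue_above:
  assumes "0 \<le> d" "height \<eta> d = height \<zeta> d" "d \<le> k"
  shows "height (glue d \<eta> \<zeta>) k = height \<zeta> k"
  using assms(3)
proof (induction k rule: int_ge_induct)
  case base
  show ?case using assms by (simp add: height_glue_below)
next
  case (step k)
  then show ?case
    using height_step[of "glue d \<eta> \<zeta>" "k + 1"] height_step[of \<zeta> "k + 1"] by (simp add: glue_def)
qed

text \<open>Beyond a cut \<open>x\<close> in \<open>A\<close> all heights are below the height at
  \<open>x\<close>, so for \<open>a \<le> x\<close> membership in \<open>A\<close> is decided by the
  heights up to \<open>x\<close>: a common cut hides the future.\<close>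

lemma A_set_agree_below:
  assumes "\<And>k. k \<le> x \<Longrightarrow> height \<xi> k = height \<eta> k" "x \<in> A_set \<xi>" "x \<in> A_set \<eta>"
  shows "A_set \<eta> \<inter> {..x} = A_set \<xi> \<inter> {..x}"
proof -
  have iff: "a \<in> A_set \<xi> \<longleftrightarrow> (\<forall>r. a < r \<and> r \<le> x \<longrightarrow> height \<xi> r < height \<xi> a)"
    if "a \<le> x" "x \<in> A_set \<xi>" for a \<xi>
  proof
    assume *: "\<forall>r. a < r \<and> r \<le> x \<longrightarrow> height \<xi> r < height \<xi> a"
    show "a \<in> A_set \<xi>"
      unfolding A_set_iff
    proof (intro allI impI)
      fix r assume r: "a < r"
      show "height \<xi> r < height \<xi> a"
      proof (cases "r \<le> x")
        case True
        then show ?thesis using * r by simp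
      next
        case False
        then have "height \<xi> r < height \<xi> x" using that(2) by (simp add: A_set_iff)
        moreover have "a = x \<or> height \<xi> x < height \<xi> a" using * that(1) by (cases "a = x") auto
        ultimately show ?thesis by auto
      qed
    qed
  qed (simp add: A_set_iff)
  then have "a \<in> A_set \<eta> \<longleftrightarrow> a \<in> A_set \<xi>" if "a \<le> x" for a
    unfolding iff[OF that assms(2)] iff[OF that assms(3)] using assms(1) that by (simp cong: conj_cong)
  then show ?thesis by auto
qed

lemma B_set_agree_below:
  assumes "\<And>k. k \<le> x \<Longrightarrow> height \<xi> k = height \<eta> k" "x \<in> B_set \<xi>" "x \<in> B_set \<eta>"
  shows "B_set \<eta> \<inter> {..x} = B_set \<xi> \<inter> {..x}"
proof -
  have iff: "b \<in> B_set \<xi> \<longleftrightarrow> (\<forall>r. b < r \<and> r \<le> x \<longrightarrow> 3 * height \<xi> b + b < 3 * height \<xi> r + r)"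
    if "b \<le> x" "x \<in> B_set \<xi>" for b \<xi>
  proof
    assume *: "\<forall>r. b < r \<and> r \<le> x \<longrightarrow> 3 * height \<xi> b + b < 3 * height \<xi> r + r"
    show "b \<in> B_set \<xi>"
      unfolding B_set_iff
    proof (intro allI impI)
      fix r assume r: "b < r"
      show "3 * height \<xi> b + b < 3 * height \<xi> r + r"
      proof (cases "r \<le> x")
        case True
        then show ?thesis using * r by simp
      next
        case False
        then have "3 * height \<xi> x + x < 3 * height \<xi> r + r" using that(2) by (simp add: B_set_iff)
        moreover have "b = x \<or> 3 * height \<xi> b + b < 3 * height \<xi> x + x" using * that(1) by (cases "b = x") auto
        ultimately show ?thesis by auto
      qed
    qed
  qed (simp add: B_set_iff)
  then have "b \<in> B_set \<eta> \<longleftrightarrow> b \<in> B_set \<xi>" if "b \<le> x" for b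
    unfolding iff[OF that assms(2)] iff[OF that assms(3)] using assms(1) that by (simp cong: conj_cong)
  then show ?thesis by auto
qed

lemma biinfinite_glue:
  assumes "biinfinite S1" "biinfinite S2" "S1 \<inter> {..x} = S \<inter> {..x}" "S2 \<inter> {y..} = S \<inter> {y..}"
  shows "biinfinite S"
  unfolding biinfinite_def
proof (intro allI conjI)
  fix n
  obtain s where s: "s \<in> S1" "s < min n x" using assms(1) unfolding biinfinite_def by metis
  then have "s \<in> S1 \<inter> {..x}" by simp
  then have "s \<in> S" unfolding assms(3) by simp
  then show "\<exists>s\<in>S. s < n" using s(2) by (intro bexI[of _ s]) simp_all
  obtain t where t: "t \<in> S2" "max n y < t" using assms(2) unfolding biinfinite_def by metis
  then have "t \<in> S2 \<inter> {y..}" by simp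
  then have "t \<in> S" unfolding assms(4) by simp
  then show "\<exists>s\<in>S. n < s" using t(2) by (intro bexI[of _ t]) simp_all
qed

text \<open>Indices are anchored at \<open>p_0 = 0 \<le> d\<close>, so agreement up to
  \<open>d\<close> preserves \<open>p_k\<close> for \<open>k \<le> 0\<close> and \<open>q_k\<close>
  for \<open>k < 0\<close>. The point \<open>q_0\<close> may lie beyond \<open>d\<close> and is
  treated apart.\<close>

lemma V_core_agree_below:
  assumes \<eta>: "\<eta> \<in> V_core" and g: "good_config \<xi>" and d: "0 \<le> d"
    and P: "P_set \<eta> \<inter> {..d} = P_set \<xi> \<inter> {..d}" and Q: "Q_set \<eta> \<inter> {..d} = Q_set \<xi> \<inter> {..d}"
  shows "\<xi> \<in> V_core" "k \<le> 0 \<Longrightarrow> p_point \<xi> k = p_point \<eta> k" "k < 0 \<Longrightarrow> q_point \<xi> k = q_point \<eta> k"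
proof -
  have iff: "x \<in> P_set \<xi> \<longleftrightarrow> x \<in> P_set \<eta>" if "x \<le> d" for x using P that by blast
  then show V: "\<xi> \<in> V_core" using V_coreD(2)[OF \<eta>] g d by (simp add: V_core_def)
  have P0: "P_set \<xi> \<inter> {..p_point \<xi> 0} = P_set \<eta> \<inter> {..p_point \<xi> 0}"
    using iff d by (auto simp: p_point_props(2)[OF V])
  show p: "p_point \<xi> k = p_point \<eta> k" if "k \<le> 0" for k
    using increasing_indexing_agree_below[OF p_point_props(1)[OF V] p_point_props(1)[OF \<eta>] _ P0 that]
      p_point_props(2)[OF V] p_point_props(2)[OF \<eta>] by simp
  show "q_point \<xi> k = q_point \<eta> k" if "k < 0"
  proof (rule q_point_eqI[OF V])
    have "p_point \<eta> (k + 1) \<le> p_point \<eta> 0"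
      using that strict_mono_less_eq[OF increasing_indexingD(1)[OF p_point_props(1)[OF \<eta>]]] by simp
    then have "q_point \<eta> k \<le> d"
      using q_point_props(3)[OF \<eta>, of k] p_point_props(2)[OF \<eta>] d by simp
    then show "q_point \<eta> k \<in> Q_set \<xi>" using q_point_in[OF \<eta>, of k] Q by blast
    show "p_point \<xi> k < q_point \<eta> k" "q_point \<eta> k < p_point \<xi> (k + 1)"
      using p[of k] p[of "k + 1"] that q_point_props(2,3)[OF \<eta>, of k] by simp_all
  qed
qed

lemma p_point_A: "\<eta> \<in> V_core \<Longrightarrow> p_point \<eta> k \<in> A_set \<eta>"
  using p_point_in P_subset_A V_coreD(1) by blast

lemma q_point_B: "\<eta> \<in> V_core \<Longrightarrow> q_point \<eta> k \<in> B_set \<eta>"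
  using q_point_in Q_subset_B V_coreD(1) by blast

lemma q_point_neg:
  assumes \<eta>: "\<eta> \<in> V_core" and "k < 0"
  shows "q_point \<eta> k < 0"
proof -
  have "p_point \<eta> (k + 1) \<le> p_point \<eta> 0"
    using assms(2) strict_mono_less_eq[OF increasing_indexingD(1)[OF p_point_props(1)[OF \<eta>]]] by simp
  then show ?thesis using q_point_props(3)[OF \<eta>, of k] p_point_props(2)[OF \<eta>] by simp
qed

lemma p_point_nonpos:
  assumes \<eta>: "\<eta> \<in> V_core" and "k \<le> 0"
  shows "p_point \<eta> k \<le> 0"
  using assms(2) strict_mono_less_eq[OF increasing_indexingD(1)[OF p_point_props(1)[OF \<eta>]], of k 0]
    p_point_props(2)[OF \<eta>] by simp

lemma switch_sets_agree_below:
  assumes "good_config \<eta>" "good_config \<xi>" "x \<in> A_set \<eta>" "x \<in> A_set \<xi>" "q \<in> B_set \<eta>" "q \<in> B_set \<xi>" "q < x"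
    and "{q<..<x} \<inter> A_set \<eta> = {}" "A_set \<eta> \<inter> {..x} = A_set \<xi> \<inter> {..x}" "B_set \<eta> \<inter> {..q} = B_set \<xi> \<inter> {..q}"
  shows "P_set \<eta> \<inter> {..x} = P_set \<xi> \<inter> {..x}" "Q_set \<eta> \<inter> {..x} = Q_set \<xi> \<inter> {..x}"
proof -
  have disj: "A_set \<eta> \<inter> B_set \<eta> = {}" "A_set \<xi> \<inter> B_set \<xi> = {}" using A_B_disjoint by blast+
  then have "x \<notin> B_set \<eta>" "x \<notin> B_set \<xi>" using assms(3,4) by blast+
  note * = switch_points_agree_below[OF assms(3-7) this assms(8-10) disj]
  show "P_set \<eta> \<inter> {..x} = P_set \<xi> \<inter> {..x}" "Q_set \<eta> \<inter> {..x} = Q_set \<xi> \<inter> {..x}"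
    using *(1) *(2) by (simp_all only: P_set_eq[OF assms(1)] P_set_eq[OF assms(2)] Q_set_eq[OF assms(1)] Q_set_eq[OF assms(2)])
qed

lemma switch_sets_agree_below':
  assumes "good_config \<eta>" "good_config \<xi>" "x \<in> B_set \<eta>" "x \<in> B_set \<xi>" "q \<in> A_set \<eta>" "q \<in> A_set \<xi>" "q < x"
    and "{q<..<x} \<inter> B_set \<eta> = {}" "B_set \<eta> \<inter> {..x} = B_set \<xi> \<inter> {..x}" "A_set \<eta> \<inter> {..q} = A_set \<xi> \<inter> {..q}"
  shows "P_set \<eta> \<inter> {..x} = P_set \<xi> \<inter> {..x}" "Q_set \<eta> \<inter> {..x} = Q_set \<xi> \<inter> {..x}"
proof -
  have disj: "B_set \<eta> \<inter> A_set \<eta> = {}" "B_set \<xi> \<inter> A_set \<xi> = {}" using A_B_disjoint by blast+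
  then have "x \<notin> A_set \<eta>" "x \<notin> A_set \<xi>" using assms(3,4) by blast+
  note * = switch_points_agree_below[OF assms(3-7) this assms(8-10) disj]
  show "P_set \<eta> \<inter> {..x} = P_set \<xi> \<inter> {..x}" "Q_set \<eta> \<inter> {..x} = Q_set \<xi> \<inter> {..x}"
    using *(2) *(1) by (simp_all only: P_set_eq[OF assms(1)] P_set_eq[OF assms(2)] Q_set_eq[OF assms(1)] Q_set_eq[OF assms(2)])
qed

text \<open>Shared by the cut at \<open>p_0\<close>, where \<open>d = 0\<close>, and the cut at
  \<open>q_0\<close>, where \<open>d = q_0\<close>. Equal heights at \<open>d\<close> make the glued
  path inherit absolute heights, not just increments, from both configurations.\<close>

locale glued =
  fixes d :: int and \<eta> \<zeta> \<xi> :: config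
  assumes \<eta>: "\<eta> \<in> V_core" and \<zeta>: "\<zeta> \<in> V_core" and d: "0 \<le> d"
    and eq_d: "height \<eta> d = height \<zeta> d"
  defines "\<xi> \<equiv> glue d \<eta> \<zeta>"
begin

lemma height_below: "k \<le> d \<Longrightarrow> height \<xi> k = height \<eta> k"
  unfolding \<xi>_def using d by (rule height_glue_below)

lemma height_above: "d \<le> k \<Longrightarrow> height \<xi> k = height \<zeta> k"
  unfolding \<xi>_def using d eq_d by (rule height_glue_above)

lemma A_set_above: "d \<le> a \<Longrightarrow> a \<in> A_set \<xi> \<longleftrightarrow> a \<in> A_set \<zeta>"
  by (simp add: A_set_iff height_above)

lemma B_set_above: "d \<le> b \<Longrightarrow> b \<in> B_set \<xi> \<longleftrightarrow> b \<in> B_set \<zeta>"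
  by (simp add: B_set_iff height_above)

text \<open>One point of each kind that survives the gluing suffices: up to it the set is that of
  \<open>\<eta>\<close>, from \<open>d\<close> on it is that of \<open>\<zeta>\<close>, so
  unboundedness is inherited on each side.\<close>

lemma good:
  assumes "x \<le> d" "x \<in> A_set \<xi>" "x \<in> A_set \<eta>" and "y \<le> d" "y \<in> B_set \<xi>" "y \<in> B_set \<eta>"
  shows "good_config \<xi>" "A_set \<eta> \<inter> {..x} = A_set \<xi> \<inter> {..x}" "B_set \<eta> \<inter> {..y} = B_set \<xi> \<inter> {..y}"
proof -
  show A: "A_set \<eta> \<inter> {..x} = A_set \<xi> \<inter> {..x}"
    using assms height_below by (intro A_set_agree_below) auto
  show B: "B_set \<eta> \<inter> {..y} = B_set \<xi> \<inter> {..y}"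
    using assms height_below by (intro B_set_agree_below) auto
  have "A_set \<zeta> \<inter> {d..} = A_set \<xi> \<inter> {d..}" "B_set \<zeta> \<inter> {d..} = B_set \<xi> \<inter> {d..}"
    by (auto simp: A_set_above B_set_above)
  then show "good_config \<xi>"
    using biinfinite_glue[OF _ _ A] biinfinite_glue[OF _ _ B] V_coreD(1)[OF \<eta>] V_coreD(1)[OF \<zeta>]
    unfolding good_config_def by blast
qed

end

text \<open>Since \<open>p_0 = 0\<close>, equality of \<open>Y_0\<close> means that both
  configurations have the same \<open>q_{-1}\<close> at the same height. The future of
  \<open>\<zeta>\<close> therefore respects the levels set by the past of
  \<open>\<eta>\<close>.\<close>

lemma swap_at_P:
  assumes \<eta>: "\<eta> \<in> V_core" and \<zeta>: "\<zeta> \<in> V_core" and Y: "Y_proc 0 \<eta> = Y_proc 0 \<zeta>"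
  defines "\<xi> \<equiv> glue 0 \<eta> \<zeta>"
  shows "\<xi> \<in> V_core" "i \<le> 0 \<Longrightarrow> Y_proc i \<xi> = Y_proc i \<eta>" "Y_proc 1 \<xi> = Y_proc 1 \<zeta>"
proof -
  note p0 = p_point_props(2)
  interpret glued 0 \<eta> \<zeta> \<xi>
    by unfold_locales (use \<eta> \<zeta> in \<open>simp_all add: height_zero \<xi>_def\<close>)
  define q where "q = q_point \<eta> (-1)"
  have q: "q_point \<zeta> (-1) = q" "height \<zeta> q = height \<eta> q"
    using Y p0[OF \<eta>] p0[OF \<zeta>] Y_proc_even[of 0 \<eta>] Y_proc_even[of 0 \<zeta>] by (auto simp: height_zero q_def)
  have q0: "q < 0" using q_point_neg[OF \<eta>, of "-1"] by (simp add: q_def)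
  have A0: "0 \<in> A_set \<eta>" "0 \<in> A_set \<zeta>" using p_point_A[OF \<eta>, of 0] p_point_A[OF \<zeta>, of 0] p0 \<eta> \<zeta> by simp_all
  then have A0': "0 \<in> A_set \<xi>" by (simp add: A_set_above)
  have Bq: "q \<in> B_set \<eta>" "q \<in> B_set \<zeta>" using q_point_B[OF \<eta>, of "-1"] q_point_B[OF \<zeta>, of "-1"] q by (simp_all add: q_def)
  \<comment> \<open>Up to 0 the inequality is the one for \<open>\<eta>\<close>, beyond 0 the one
    for \<open>\<zeta>\<close>; they refer to the same level because the heights at \<open>q\<close>
    agree.\<close>
  have Bq': "q \<in> B_set \<xi>"
    unfolding B_set_iff
  proof (intro allI impI)
    fix r assume "q < r"
    then show "3 * height \<xi> q + q < 3 * height \<xi> r + r"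
      using Bq q0 q(2) unfolding B_set_iff by (cases "r \<le> 0") (simp_all add: height_below height_above)
  qed
  note good = good[OF _ A0' A0(1) _ Bq' Bq(1)]
  have g: "good_config \<xi>" using good(1) q0 by simp
  have gap: "{q<..<0} \<inter> A_set \<eta> = {}"
    using p_point_least[OF \<eta>, of _ 0] p0[OF \<eta>] by (force simp: q_def)
  note PQ = switch_sets_agree_below[OF V_coreD(1)[OF \<eta>] g A0(1) A0' Bq(1) Bq' q0 gap]
  have P: "P_set \<eta> \<inter> {..0} = P_set \<xi> \<inter> {..0}" and Q: "Q_set \<eta> \<inter> {..0} = Q_set \<xi> \<inter> {..0}"
    using PQ good q0 by simp_all
  note core = V_core_agree_below[OF \<eta> g order.refl P Q]
  show V: "\<xi> \<in> V_core" by (rule core(1))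
  show "Y_proc i \<xi> = Y_proc i \<eta>" if "i \<le> 0"
  proof -
    define k where "k = i div 2"
    \<comment> \<open>An odd index \<open>i \<le> 0\<close> has \<open>k < 0\<close>, so only points
      \<open>q_k\<close> before the cut occur.\<close>
    have "i = 2 * k \<and> k \<le> 0 \<or> i = 2 * k + 1 \<and> k < 0" unfolding k_def using that by presburger
    then consider "i = 2 * k" "k \<le> 0" | "i = 2 * k + 1" "k < 0" by blast
    then show ?thesis
    proof cases
      case 1
      then show ?thesis
        using q_point_neg[OF \<eta>, of "k - 1"] p_point_nonpos[OF \<eta>, of k]
        by (simp add: Y_proc_even core height_below)
    next
      case 2
      then show ?thesis
        using q_point_neg[OF \<eta>, of k] p_point_nonpos[OF \<eta>, of k]
        by (simp add: Y_proc_odd core height_below)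
    qed
  qed
  have pos: "0 < q_point \<zeta> 0" using q_point_props(2)[OF \<zeta>, of 0] p0[OF \<zeta>] by simp
  \<comment> \<open>The next increment ends at the first point of \<open>B\<close> after 0, and
    there \<open>\<xi>\<close> and \<open>\<zeta>\<close> have the same points of
    \<open>B\<close>.\<close>
  have "q_point \<xi> 0 = q_point \<zeta> 0"
  proof (rule q_point_first_B[OF V])
    show "q_point \<zeta> 0 \<in> B_set \<xi>" using pos q_point_B[OF \<zeta>] by (simp add: B_set_above)
    show "p_point \<xi> 0 < q_point \<zeta> 0" using pos p0[OF V] by simp
    show "q_point \<zeta> 0 \<le> t" if "t \<in> B_set \<xi>" "p_point \<xi> 0 < t" for t
      using that q_point_least[OF \<zeta>, of t 0] p0[OF V] p0[OF \<zeta>] by (simp add: B_set_above)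
  qed
  then show "Y_proc 1 \<xi> = Y_proc 1 \<zeta>"
    using Y_proc_odd[of 0 \<xi>] Y_proc_odd[of 0 \<zeta>] p0[OF V] p0[OF \<zeta>] pos
    by (simp add: height_above)
qed

text \<open>Since \<open>p_0 = 0\<close>, \<open>Y_1\<close> is \<open>(q_0, h(q_0))\<close>, so
  equality gives a common cut with a common height. The condition to preserve is
  \<open>0 \<in> A\<close>: \<open>\<eta>\<close> secures it up to \<open>d\<close>,
  \<open>\<zeta>\<close> after \<open>d\<close>, both relative to height 0 at time 0.\<close>

lemma swap_at_Q:
  assumes \<eta>: "\<eta> \<in> V_core" and \<zeta>: "\<zeta> \<in> V_core" and Y: "Y_proc 1 \<eta> = Y_proc 1 \<zeta>"
  defines "\<xi> \<equiv> glue (fst (Y_proc 1 \<eta>)) \<eta> \<zeta>"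
  shows "\<xi> \<in> V_core" "i \<le> 1 \<Longrightarrow> Y_proc i \<xi> = Y_proc i \<eta>" "Y_proc 2 \<xi> = Y_proc 2 \<zeta>"
proof -
  note p0 = p_point_props(2)
  define d where "d = fst (Y_proc 1 \<eta>)"
  have dq: "q_point \<eta> 0 = d" "q_point \<zeta> 0 = d" "height \<eta> d = height \<zeta> d"
    using Y p0[OF \<eta>] p0[OF \<zeta>] Y_proc_odd[of 0 \<eta>] Y_proc_odd[of 0 \<zeta>] by (auto simp: height_zero d_def)
  have d0: "0 < d" using q_point_props(2)[OF \<eta>, of 0] p0[OF \<eta>] dq by simp
  interpret glued d \<eta> \<zeta> \<xi>
    by unfold_locales (use \<eta> \<zeta> dq d0 in \<open>simp_all add: \<xi>_def d_def\<close>)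
  have A0: "0 \<in> A_set \<eta>" "0 \<in> A_set \<zeta>" using p_point_A[OF \<eta>, of 0] p_point_A[OF \<zeta>, of 0] p0 \<eta> \<zeta> by simp_all
  have Bd: "d \<in> B_set \<eta>" "d \<in> B_set \<zeta>" using q_point_B[OF \<eta>, of 0] q_point_B[OF \<zeta>, of 0] dq by simp_all
  then have Bd': "d \<in> B_set \<xi>" by (simp add: B_set_above)
  have A0': "0 \<in> A_set \<xi>"
    unfolding A_set_iff
  proof (intro allI impI)
    fix r :: int assume "0 < r"
    then show "height \<xi> r < height \<xi> 0"
      using A0 d0 unfolding A_set_iff by (cases "r \<le> d") (simp_all add: height_below height_above height_zero)
  qed
  note good = good[OF _ A0' A0(1) _ Bd' Bd(1)]
  have g: "good_config \<xi>" using good(1) d0 by simp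
  have gap: "{0<..<d} \<inter> B_set \<eta> = {}"
    using q_point_least[OF \<eta>, of _ 0] p0[OF \<eta>] dq by force
  note PQ = switch_sets_agree_below'[OF V_coreD(1)[OF \<eta>] g Bd(1) Bd' A0(1) A0' d0 gap]
  have P: "P_set \<eta> \<inter> {..d} = P_set \<xi> \<inter> {..d}" and Q: "Q_set \<eta> \<inter> {..d} = Q_set \<xi> \<inter> {..d}"
    using PQ good d0 by simp_all
  note core = V_core_agree_below[OF \<eta> g less_imp_le[OF d0] P Q]
  show V: "\<xi> \<in> V_core" by (rule core(1))
  \<comment> \<open>Agreement up to \<open>d\<close> has fixed \<open>q_k\<close> only for
    \<open>k < 0\<close>; \<open>q_0 = d\<close> is recovered as the first point of \<open>B\<close>
    after 0.\<close>
  have q0: "q_point \<xi> 0 = d"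
  proof (rule q_point_first_B[OF V Bd'])
    show "p_point \<xi> 0 < d" using d0 p0[OF V] by simp
    show "d \<le> t" if "t \<in> B_set \<xi>" "p_point \<xi> 0 < t" for t
    proof (rule ccontr)
      assume "\<not> d \<le> t"
      then have "t \<in> B_set \<xi> \<inter> {..d}" using that by simp
      then have "t \<in> B_set \<eta>" using good(3) d0 by (metis IntD1 less_imp_le order.refl)
      then have "t \<in> {0<..<d} \<inter> B_set \<eta>" using \<open>\<not> d \<le> t\<close> that p0[OF V] by simp
      then show False using gap by blast
    qed
  qed
  show "Y_proc i \<xi> = Y_proc i \<eta>" if "i \<le> 1"
  proof -
    define k where "k = i div 2"
    have "i = 2 * k \<and> k \<le> 0 \<or> i = 2 * k + 1 \<and> k < 0 \<or> i = 2 * 0 + 1" unfolding k_def using that by presburger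
    then consider "i = 2 * k" "k \<le> 0" | "i = 2 * k + 1" "k < 0" | "i = 2 * 0 + 1" by blast
    then show ?thesis
    proof cases
      case 1
      then show ?thesis
        using q_point_neg[OF \<eta>, of "k - 1"] p_point_nonpos[OF \<eta>, of k] d0
        by (simp add: Y_proc_even core height_below)
    next
      case 2
      then show ?thesis
        using q_point_neg[OF \<eta>, of k] p_point_nonpos[OF \<eta>, of k] d0
        by (simp add: Y_proc_odd core height_below)
    next
      case 3
      then show ?thesis
        using p0[OF V] p0[OF \<eta>] q0 dq d0
        by (simp only: Y_proc_odd) (simp add: height_below height_zero)
    qed
  qed
  have gt: "d < p_point \<zeta> 1" using q_point_props(3)[OF \<zeta>, of 0] dq by simp
  have "p_point \<xi> 1 = p_point \<zeta> 1"
  proof (rule p_point_first_A[OF V])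
    show "p_point \<zeta> 1 \<in> A_set \<xi>" using gt p_point_A[OF \<zeta>] by (simp add: A_set_above)
    show "q_point \<xi> (1 - 1) < p_point \<zeta> 1" using gt q0 by simp
    show "p_point \<zeta> 1 \<le> t" if "t \<in> A_set \<xi>" "q_point \<xi> (1 - 1) < t" for t
      using that p_point_least[OF \<zeta>, of t 1] dq q0 by (simp add: A_set_above)
  qed
  then show "Y_proc 2 \<xi> = Y_proc 2 \<zeta>"
    using Y_proc_even[of 1 \<xi>] Y_proc_even[of 1 \<zeta>] gt q0 dq
    by (simp add: height_above)
qed

section \<open>Measurability and stationarity\<close>

lemma prob_space_bernoulli_product: "prob_space (bernoulli_product \<rho>)"
  unfolding bernoulli_product_def by (intro prob_space_PiM measure_pmf.prob_space_axioms)

lemma space_bernoulli_product [simp]: "space (bernoulli_product \<rho>) = UNIV"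
  by (simp add: bernoulli_product_def space_PiM)

lemma sets_bernoulli_product:
  "sets (bernoulli_product \<rho>) = sets (\<Pi>\<^sub>M i\<in>(UNIV :: int set). count_space (UNIV :: bool set))"
  unfolding bernoulli_product_def by (intro sets_PiM_cong) simp_all

lemma measurable_coordinate [measurable]:
  "(\<lambda>\<eta>. \<eta> i) \<in> measurable (bernoulli_product \<rho>) (count_space UNIV)"
  unfolding measurable_cong_sets[OF sets_bernoulli_product refl] by measurable

lemma height_real:
  "real_of_int (height \<eta> k) =
    (\<Sum>i\<in>{0<..k}. if \<eta> i then - 1 else 1) - (\<Sum>i\<in>{k<..0}. if \<eta> i then - 1 else 1)"
proof -
  have "real_of_int (\<Sum>i\<in>S. (-1) ^ of_bool (\<eta> i)) = (\<Sum>i\<in>S. if \<eta> i then - 1 else 1)" for S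
    unfolding of_int_sum by (intro sum.cong) auto
  then show ?thesis by (simp add: height_def)
qed

lemma measurable_height [measurable]:
  "(\<lambda>\<eta>. real_of_int (height \<eta> k)) \<in> borel_measurable (bernoulli_product \<rho>)"
  unfolding height_real by measurable

lemma pred_A_set [measurable]: "Measurable.pred (bernoulli_product \<rho>) (\<lambda>\<eta>. a \<in> A_set \<eta>)"
proof -
  have iff: "a \<in> A_set \<eta> \<longleftrightarrow> (\<forall>r. a < r \<longrightarrow> real_of_int (height \<eta> r) < real_of_int (height \<eta> a))" for \<eta>
    by (simp add: A_set_iff)
  show ?thesis unfolding iff by measurable
qed

lemma pred_B_set [measurable]: "Measurable.pred (bernoulli_product \<rho>) (\<lambda>\<eta>. b \<in> B_set \<eta>)"
proof -
  have iff: "b \<in> B_set \<eta> \<longleftrightarrow> (\<forall>r. b < r \<longrightarrow>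
      3 * real_of_int (height \<eta> b) + real_of_int b < 3 * real_of_int (height \<eta> r) + real_of_int r)" for \<eta>
    unfolding B_set_iff by (intro all_cong1 imp_cong refl) linarith
  show ?thesis unfolding iff by measurable
qed

lemma pred_good_config [measurable]: "Measurable.pred (bernoulli_product \<rho>) good_config"
  unfolding good_config_def biinfinite_def Bex_def by measurable

text \<open>On good configurations \<open>P_set\<close> is \<open>switch_points\<close>, a countable
  combination of membership events for single integers; the conjunct confines the event to
  them.\<close>

lemma pred_P_set [measurable]:
  "Measurable.pred (bernoulli_product \<rho>) (\<lambda>\<eta>. good_config \<eta> \<and> p \<in> P_set \<eta>)"
proof -
  have iff: "good_config \<eta> \<and> p \<in> P_set \<eta> \<longleftrightarrow> good_config \<eta> \<and> p \<in> A_set \<eta> \<and>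
      (\<exists>b. b \<in> B_set \<eta> \<and> b < p \<and> (\<forall>t. b < t \<and> t < p \<longrightarrow> t \<notin> A_set \<eta>))" for \<eta>
    by (auto simp: P_set_eq switch_points_def disjoint_iff Bex_def)
  show ?thesis unfolding iff by measurable
qed

lemma pred_Q_set [measurable]:
  "Measurable.pred (bernoulli_product \<rho>) (\<lambda>\<eta>. good_config \<eta> \<and> q \<in> Q_set \<eta>)"
proof -
  have iff: "good_config \<eta> \<and> q \<in> Q_set \<eta> \<longleftrightarrow> good_config \<eta> \<and> q \<in> B_set \<eta> \<and>
      (\<exists>b. b \<in> A_set \<eta> \<and> b < q \<and> (\<forall>t. b < t \<and> t < q \<longrightarrow> t \<notin> B_set \<eta>))" for \<eta>
    by (auto simp: Q_set_eq switch_points_def disjoint_iff Bex_def)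
  show ?thesis unfolding iff by measurable
qed

lemma pred_V_core [measurable]: "Measurable.pred (bernoulli_product \<rho>) (\<lambda>\<eta>. \<eta> \<in> V_core)"
  unfolding V_core_def by simp

lemma V_core_sets [measurable]: "V_core \<in> sets (bernoulli_product \<rho>)"
  using pred_V_core[where \<rho> = \<rho>] by (simp add: pred_def)

text \<open>A neighbouring point is recognised by membership of integers in \<open>S\<close>, which
  makes measurability of \<open>p_k\<close> an induction on \<open>k\<close>.\<close>

lemma increasing_indexing_step:
  assumes "increasing_indexing S f"
  shows "f (k + 1) = x \<longleftrightarrow> x \<in> S \<and> f k < x \<and> (\<forall>t. f k < t \<and> t < x \<longrightarrow> t \<notin> S)"
    and "f k = x \<longleftrightarrow> x \<in> S \<and> x < f (k + 1) \<and> (\<forall>t. x < t \<and> t < f (k + 1) \<longrightarrow> t \<notin> S)"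
proof -
  note f = increasing_indexingD[OF assms]
  have less: "f k < f (k + 1)" using f(1) by (simp add: strict_mono_less)
  have gap: "t \<notin> S" if "f k < t" "t < f (k + 1)" for t using increasing_indexing_gap[OF assms] that by blast
  show "f (k + 1) = x \<longleftrightarrow> x \<in> S \<and> f k < x \<and> (\<forall>t. f k < t \<and> t < x \<longrightarrow> t \<notin> S)"
    using f(2)[of "k + 1"] less gap by (metis linorder_neqE)
  show "f k = x \<longleftrightarrow> x \<in> S \<and> x < f (k + 1) \<and> (\<forall>t. x < t \<and> t < f (k + 1) \<longrightarrow> t \<notin> S)"
    using f(2)[of k] less gap by (metis linorder_neqE)
qed

text \<open>The induction runs outwards from \<open>p_0 = 0\<close> in both directions and
  quantifies over the value of the previous point. The conjunct \<open>\<eta> \<in> V_core\<close>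
  confines the definite description \<open>p_point\<close> to where it has a meaning.\<close>

lemma pred_p_point [measurable]:
  "Measurable.pred (bernoulli_product \<rho>) (\<lambda>\<eta>. \<eta> \<in> V_core \<and> p_point \<eta> k = x)"
proof (induction k arbitrary: x rule: int_induct[where k = 0])
  case base
  have iff: "\<eta> \<in> V_core \<and> p_point \<eta> 0 = x \<longleftrightarrow> \<eta> \<in> V_core \<and> x = 0" for \<eta>
    using p_point_props(2)[of \<eta>] by auto
  show ?case unfolding iff by measurable
next
  case (step1 k)
  note step1.IH[measurable]
  have iff: "\<eta> \<in> V_core \<and> p_point \<eta> (k + 1) = x \<longleftrightarrow> \<eta> \<in> V_core \<and> (good_config \<eta> \<and> x \<in> P_set \<eta>) \<and>
      (\<exists>z. (\<eta> \<in> V_core \<and> p_point \<eta> k = z) \<and> z < x \<and>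
        (\<forall>t. z < t \<and> t < x \<longrightarrow> \<not> (good_config \<eta> \<and> t \<in> P_set \<eta>)))" for \<eta>
    using increasing_indexing_step(1)[OF p_point_props(1), of \<eta> k x] V_coreD(1)[of \<eta>] by blast
  show ?case unfolding iff by measurable
next
  case (step2 k)
  note step2.IH[measurable]
  have iff: "\<eta> \<in> V_core \<and> p_point \<eta> (k - 1) = x \<longleftrightarrow> \<eta> \<in> V_core \<and> (good_config \<eta> \<and> x \<in> P_set \<eta>) \<and>
      (\<exists>z. (\<eta> \<in> V_core \<and> p_point \<eta> k = z) \<and> x < z \<and>
        (\<forall>t. x < t \<and> t < z \<longrightarrow> \<not> (good_config \<eta> \<and> t \<in> P_set \<eta>)))" for \<eta>
    using increasing_indexing_step(2)[OF p_point_props(1), of \<eta> "k - 1" x] V_coreD(1)[of \<eta>] by auto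
  show ?case unfolding iff by measurable
qed

lemma pred_q_point [measurable]:
  "Measurable.pred (bernoulli_product \<rho>) (\<lambda>\<eta>. \<eta> \<in> V_core \<and> q_point \<eta> k = x)"
proof -
  have iff: "\<eta> \<in> V_core \<and> q_point \<eta> k = x \<longleftrightarrow> \<eta> \<in> V_core \<and> (good_config \<eta> \<and> x \<in> Q_set \<eta>) \<and>
      (\<exists>a b. (\<eta> \<in> V_core \<and> p_point \<eta> k = a) \<and> (\<eta> \<in> V_core \<and> p_point \<eta> (k + 1) = b) \<and> a < x \<and> x < b)" for \<eta>
    using q_point_eqI[of \<eta> x k] q_point_props(2,3)[of \<eta> k] q_point_in[of \<eta> k] V_coreD(1)[of \<eta>] by blast
  show ?thesis unfolding iff by measurable
qed

lemma pred_Y_proc [measurable]: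
  "Measurable.pred (bernoulli_product \<rho>) (\<lambda>\<eta>. \<eta> \<in> V_core \<and> Y_proc j \<eta> = y)"
proof -
  have height: "height \<eta> a - height \<eta> b = c \<longleftrightarrow> real_of_int (height \<eta> a) - real_of_int (height \<eta> b) = real_of_int c"
    for \<eta> a b c by (simp flip: of_int_diff)
  define k where "k = j div 2"
  show ?thesis
  proof (cases "even j")
    case True
    then have j: "j = 2 * k" by (simp add: k_def)
    have iff: "\<eta> \<in> V_core \<and> Y_proc j \<eta> = y \<longleftrightarrow>
        (\<exists>a b. (\<eta> \<in> V_core \<and> p_point \<eta> k = a) \<and> (\<eta> \<in> V_core \<and> q_point \<eta> (k - 1) = b) \<and> a - b = fst y \<and>
          real_of_int (height \<eta> a) - real_of_int (height \<eta> b) = real_of_int (snd y))" for \<eta>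
      unfolding j Y_proc_even height[symmetric] by (cases y) auto
    show ?thesis unfolding iff by measurable
  next
    case False
    then have j: "j = 2 * k + 1" by (simp add: k_def)
    have iff: "\<eta> \<in> V_core \<and> Y_proc j \<eta> = y \<longleftrightarrow>
        (\<exists>a b. (\<eta> \<in> V_core \<and> q_point \<eta> k = a) \<and> (\<eta> \<in> V_core \<and> p_point \<eta> k = b) \<and> a - b = fst y \<and>
          real_of_int (height \<eta> a) - real_of_int (height \<eta> b) = real_of_int (snd y))" for \<eta>
      unfolding j Y_proc_odd height[symmetric] by (cases y) auto
    show ?thesis unfolding iff by measurable
  qed
qed

abbreviation path_space :: "(int \<Rightarrow> int \<times> int) measure" where
  "path_space \<equiv> \<Pi>\<^sub>M i\<in>UNIV. count_space UNIV"

lemma measurable_Y_proc: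
  "Y_proc j \<in> measurable (restrict_space (bernoulli_product \<rho>) V_core) (count_space UNIV)"
proof -
  have "Y_proc j -` {y} \<inter> V_core \<in> sets (restrict_space (bernoulli_product \<rho>) V_core)" for y
  proof -
    have "Y_proc j -` {y} \<inter> V_core = {\<eta>. \<eta> \<in> V_core \<and> Y_proc j \<eta> = y}" by auto
    also have "\<dots> \<in> sets (bernoulli_product \<rho>)" using pred_Y_proc[where \<rho> = \<rho> and j = j and y = y] by (simp add: pred_def)
    finally show ?thesis by (subst sets_restrict_space_iff) auto
  qed
  then show ?thesis by (simp add: measurable_count_space_eq2_countable space_restrict_space)
qed

definition Y_event :: "(int \<Rightarrow> int \<times> int) set \<Rightarrow> config set" where
  "Y_event S = {\<eta>\<in>V_core. (\<lambda>j. Y_proc j \<eta>) \<in> S}"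

lemma Y_event_sets [measurable]:
  assumes "S \<in> sets path_space"
  shows "Y_event S \<in> sets (bernoulli_product \<rho>)"
proof -
  let ?R = "restrict_space (bernoulli_product \<rho>) V_core"
  have "(\<lambda>\<eta> j. Y_proc j \<eta>) \<in> measurable ?R path_space"
    by (intro measurable_abs_UNIV measurable_Y_proc)
  from measurable_sets[OF this assms] have "(\<lambda>\<eta> j. Y_proc j \<eta>) -` S \<inter> space ?R \<in> sets ?R" .
  also have "(\<lambda>\<eta> j. Y_proc j \<eta>) -` S \<inter> space ?R = Y_event S"
    by (auto simp: Y_event_def space_restrict_space)
  finally show ?thesis by (subst (asm) sets_restrict_space_iff) auto
qed

section \<open>Translation invariance and its effect on \<open>Y\<close>\<close>

lemma measurable_shift: "shift_config x \<in> measurable (bernoulli_product \<rho>) (bernoulli_product \<rho>)"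
  unfolding measurable_cong_sets[OF refl sets_bernoulli_product] shift_config_def
  by (intro measurable_abs_UNIV measurable_coordinate)

lemma distr_shift: "distr (bernoulli_product \<rho>) (bernoulli_product \<rho>) (shift_config x) = bernoulli_product \<rho>"
  using distr_PiM_reindex[of UNIV "\<lambda>_. measure_pmf (bernoulli_pmf \<rho>)" "\<lambda>i. i + x" UNIV]
  by (simp add: bernoulli_product_def shift_config_def[abs_def] restrict_UNIV measure_pmf.prob_space_axioms inj_on_def)

lemma emeasure_shift:
  assumes "E \<in> sets (bernoulli_product \<rho>)"
  shows "emeasure (bernoulli_product \<rho>) (shift_config x -` E) = emeasure (bernoulli_product \<rho>) E"
  using emeasure_distr[OF measurable_shift assms, of x] by (simp add: distr_shift)

text \<open>Stationarity: recentring the configuration at \<open>p_k\<close> shifts the index of \<open>Y\<close> by \<open>2 * k\<close> and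
  exchanges the events \<open>p_k = x\<close> and \<open>p_{-k} = -x\<close>.\<close>

lemma Y_event_shift:
  assumes "S \<in> sets path_space"
  shows "measure (bernoulli_product \<rho>) (Y_event {f. (\<lambda>i. f (i + 2 * k)) \<in> S}) =
    measure (bernoulli_product \<rho>) (Y_event S)"
proof -
  let ?M = "bernoulli_product \<rho>"
  define F where "F x = Y_event S \<inter> {\<eta>\<in>V_core. p_point \<eta> (- k) = - x}" for x
  have F [measurable]: "F x \<in> sets ?M" for x
    unfolding F_def using Y_event_sets[OF assms, where \<rho> = \<rho>] pred_p_point[where \<rho> = \<rho> and k = "- k" and x = "- x"]
    by (auto simp: pred_def)
  have preimage: "shift_config x -` F x =
      Y_event {f. (\<lambda>i. f (i + 2 * k)) \<in> S} \<inter> {\<eta>\<in>V_core. p_point \<eta> k = x}" for x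
  proof (intro equalityI subsetI)
    fix \<eta> assume "\<eta> \<in> shift_config x -` F x"
    then have F: "shift_config x \<eta> \<in> F x" by simp
    define \<zeta> where "\<zeta> = shift_config x \<eta>"
    have \<zeta>: "\<zeta> \<in> V_core" "(\<lambda>j. Y_proc j \<zeta>) \<in> S" "- x = p_point \<zeta> (- k)"
      using F by (auto simp: F_def \<zeta>_def Y_event_def)
    have \<eta>: "\<eta> = shift_config (- x) \<zeta>" by (simp add: \<zeta>_def shift_config_inverse)
    note s = V_core_shift[OF \<zeta>(1) \<zeta>(3), folded \<eta>]
    have "(\<lambda>i. Y_proc (i + 2 * k) \<eta>) = (\<lambda>j. Y_proc j \<zeta>)" by (simp add: s(4))
    then show "\<eta> \<in> Y_event {f. (\<lambda>i. f (i + 2 * k)) \<in> S} \<inter> {\<eta>\<in>V_core. p_point \<eta> k = x}"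
      using s(1) s(2)[of k] \<zeta> p_point_props(2)[OF \<zeta>(1)] by (simp add: Y_event_def)
  next
    fix \<eta> assume "\<eta> \<in> Y_event {f. (\<lambda>i. f (i + 2 * k)) \<in> S} \<inter> {\<eta>\<in>V_core. p_point \<eta> k = x}"
    then have \<eta>: "\<eta> \<in> V_core" "x = p_point \<eta> k" "(\<lambda>i. Y_proc (i + 2 * k) \<eta>) \<in> S"
      by (auto simp: Y_event_def)
    note s = V_core_shift[OF \<eta>(1,2)]
    show "\<eta> \<in> shift_config x -` F x"
      using s(1) s(2)[of "- k"] \<eta>(3) p_point_props(2)[OF \<eta>(1)] by (simp add: F_def Y_event_def s(4))
  qed
  have disj: "disjoint_family_on F UNIV" "disjoint_family_on (\<lambda>x. shift_config x -` F x) UNIV"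
    unfolding preimage by (auto simp: disjoint_family_on_def F_def)
  \<comment> \<open>The shift by \<open>p_k\<close> is random, so the event is split by the value
    \<open>x\<close> of \<open>p_k\<close>. On each piece the shift is a fixed translation, and the
    images are again disjoint, being told apart by \<open>p_{-k} = -x\<close>.\<close>
  have "emeasure ?M (Y_event {f. (\<lambda>i. f (i + 2 * k)) \<in> S}) = emeasure ?M (\<Union>x. shift_config x -` F x)"
    unfolding preimage by (rule arg_cong[where f = "emeasure ?M"]) (auto simp: Y_event_def)
  also have "\<dots> = (\<integral>\<^sup>+x. emeasure ?M (shift_config x -` F x) \<partial>count_space UNIV)"
    using measurable_sets[OF measurable_shift F] by (intro emeasure_UN_countable disj) auto
  also have "\<dots> = (\<integral>\<^sup>+x. emeasure ?M (F x) \<partial>count_space UNIV)"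
    by (simp add: emeasure_shift)
  also have "\<dots> = emeasure ?M (\<Union>x. F x)"
    by (intro emeasure_UN_countable[symmetric] disj) auto
  also have "(\<Union>x. F x) = Y_event S"
  proof -
    have "\<eta> \<in> F (- p_point \<eta> (- k))" if "\<eta> \<in> Y_event S" for \<eta>
      using that by (simp add: F_def Y_event_def)
    moreover have "F x \<subseteq> Y_event S" for x by (auto simp: F_def)
    ultimately show ?thesis by blast
  qed
  finally show ?thesis by (simp add: measure_def)
qed

section \<open>Rectangles and the product formula\<close>

lemma indep_coordinates:
  "prob_space.indep_vars (bernoulli_product \<rho>) (\<lambda>_. count_space UNIV) (\<lambda>i \<eta>. \<eta> i) UNIV"
proof -
  let ?M = "bernoulli_product \<rho>" and ?N = "\<lambda>_::int. measure_pmf (bernoulli_pmf \<rho>)"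
  interpret prob_space ?M by (rule prob_space_bernoulli_product)
  have N: "\<And>i. prob_space (?N i)" by (rule measure_pmf.prob_space_axioms)
  have marginal: "distr ?M (count_space UNIV) (\<lambda>\<eta>. \<eta> i) = ?N i" for i
  proof -
    have "distr ?M (count_space UNIV) (\<lambda>\<eta>. \<eta> i) = distr (\<Pi>\<^sub>M i\<in>UNIV. ?N i) (?N i) (\<lambda>\<eta>. \<eta> i)"
      unfolding bernoulli_product_def by (intro distr_cong) simp_all
    also have "\<dots> = ?N i" using N by (intro distr_PiM_component) auto
    finally show ?thesis .
  qed
  have "distr ?M (\<Pi>\<^sub>M i\<in>UNIV. count_space UNIV) (\<lambda>\<eta>. \<lambda>i\<in>UNIV. \<eta> i) = distr ?M ?M (\<lambda>\<eta>. \<eta>)"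
    by (intro distr_cong sets_bernoulli_product[symmetric]) (simp_all add: restrict_UNIV)
  also have "\<dots> = (\<Pi>\<^sub>M i\<in>UNIV. distr ?M (count_space UNIV) (\<lambda>\<eta>. \<eta> i))"
    unfolding marginal by (simp add: distr_id2) (simp add: bernoulli_product_def)
  finally show ?thesis
    by (subst indep_vars_iff_distr_eq_PiM) (auto simp: measurable_coordinate)
qed

text \<open>Dependence on one side of \<open>d\<close> is expressed as invariance under changes on
  the other side, the form in which it is checked for glued configurations.\<close>

lemma indep_past_future:
  assumes E: "E1 \<in> sets (bernoulli_product \<rho>)" "E2 \<in> sets (bernoulli_product \<rho>)"
    and E1: "\<And>\<eta> \<zeta>. (\<And>i. i \<le> d \<Longrightarrow> \<eta> i = \<zeta> i) \<Longrightarrow> \<eta> \<in> E1 \<Longrightarrow> \<zeta> \<in> E1"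
    and E2: "\<And>\<eta> \<zeta>. (\<And>i. d < i \<Longrightarrow> \<eta> i = \<zeta> i) \<Longrightarrow> \<eta> \<in> E2 \<Longrightarrow> \<zeta> \<in> E2"
  shows "measure (bernoulli_product \<rho>) (E1 \<inter> E2) =
    measure (bernoulli_product \<rho>) E1 * measure (bernoulli_product \<rho>) E2"
proof -
  let ?M = "bernoulli_product \<rho>" and ?C = "\<lambda>_::int. count_space (UNIV :: bool set)"
  interpret prob_space ?M by (rule prob_space_bernoulli_product)
  define K where "K b = (if b then {..d} else {d<..})" for b
  define E where "E b = (if b then E1 else E2)" for b
  \<comment> \<open>Padding with a constant identifies \<open>E b\<close> with an event of the
    partial product, because \<open>E b\<close> ignores the padded coordinates.\<close>
  define ext where "ext b \<omega> = (\<lambda>i. if i \<in> K b then \<omega> i else False)" for b and \<omega> :: config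
  define E' where "E' b = {\<omega>\<in>space (Pi\<^sub>M (K b) ?C). ext b \<omega> \<in> E b}" for b
  have ext: "ext b \<in> measurable (Pi\<^sub>M (K b) ?C) ?M" for b
    unfolding measurable_cong_sets[OF refl sets_bernoulli_product] ext_def
  proof (rule measurable_abs_UNIV)
    show "(\<lambda>\<omega>. if i \<in> K b then \<omega> i else False) \<in> measurable (Pi\<^sub>M (K b) ?C) (count_space UNIV)" for i
      by (cases "i \<in> K b") simp_all
  qed
  have E': "E' b \<in> sets (Pi\<^sub>M (K b) ?C)" for b
    using measurable_sets[OF ext, of "E b" b] E by (simp add: E'_def E_def vimage_def Int_def conj_commute)
  have ind: "indep_vars (\<lambda>b. Pi\<^sub>M (K b) ?C) (\<lambda>b \<eta>. restrict (\<lambda>i. \<eta> i) (K b)) UNIV"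
    by (rule indep_vars_restrict[OF indep_coordinates]) (auto simp: disjoint_family_on_def K_def)
  have pre: "(\<lambda>\<eta>. restrict (\<lambda>i. \<eta> i) (K b)) -` E' b \<inter> space ?M = E b" for b
  proof -
    have "ext b (restrict \<eta> (K b)) \<in> E b \<longleftrightarrow> \<eta> \<in> E b" for \<eta>
    proof -
      have eq: "i \<in> K b \<Longrightarrow> ext b (restrict \<eta> (K b)) i = \<eta> i" for i by (simp add: ext_def)
      show ?thesis
      proof (cases b)
        case True
        then show ?thesis
          using E1[of "ext b (restrict \<eta> (K b))" \<eta>] E1[of \<eta> "ext b (restrict \<eta> (K b))"] eq
          by (auto simp: E_def K_def)
      next
        case False
        then show ?thesis
          using E2[of "ext b (restrict \<eta> (K b))" \<eta>] E2[of \<eta> "ext b (restrict \<eta> (K b))"] eq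
          by (auto simp: E_def K_def)
      qed
    qed
    then show ?thesis by (auto simp: E'_def space_PiM)
  qed
  have "prob (\<Inter>b\<in>UNIV. (\<lambda>\<eta>. restrict (\<lambda>i. \<eta> i) (K b)) -` E' b \<inter> space ?M) =
      (\<Prod>b\<in>UNIV. prob ((\<lambda>\<eta>. restrict (\<lambda>i. \<eta> i) (K b)) -` E' b \<inter> space ?M))"
    by (rule indep_varsD[OF ind]) (auto intro: E')
  then show ?thesis unfolding pre by (simp add: UNIV_bool E_def Int_commute mult.commute)
qed

text \<open>A set closed under exchanging futures after time \<open>d\<close> is a rectangle: fixing a reference point
  \<open>\<zeta>\<^sub>0\<close> of it, membership of \<open>\<eta>\<close> splits into a condition on the past of \<open>\<eta>\<close> continued by \<open>\<zeta>\<^sub>0\<close> and a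
  condition on the future of \<open>\<eta>\<close> preceded by \<open>\<zeta>\<^sub>0\<close>.\<close>

lemma measure_rectangle:
  assumes [measurable]: "E \<in> sets (bernoulli_product \<rho>)" "D \<in> sets (bernoulli_product \<rho>)" "C \<in> sets (bernoulli_product \<rho>)"
    and E: "\<And>\<eta> \<zeta>. \<eta> \<in> E \<Longrightarrow> \<zeta> \<in> E \<Longrightarrow> glue d \<eta> \<zeta> \<in> E"
    and D: "\<And>\<eta> \<zeta>. \<eta> \<in> E \<Longrightarrow> \<zeta> \<in> E \<Longrightarrow> glue d \<eta> \<zeta> \<in> D \<longleftrightarrow> \<eta> \<in> D"
    and C: "\<And>\<eta> \<zeta>. \<eta> \<in> E \<Longrightarrow> \<zeta> \<in> E \<Longrightarrow> glue d \<eta> \<zeta> \<in> C \<longleftrightarrow> \<zeta> \<in> C"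
  shows "measure (bernoulli_product \<rho>) (E \<inter> D \<inter> C) * measure (bernoulli_product \<rho>) E =
    measure (bernoulli_product \<rho>) (E \<inter> D) * measure (bernoulli_product \<rho>) (E \<inter> C)"
proof (cases "E = {}")
  case True
  then show ?thesis by simp
next
  case False
  then obtain \<zeta>\<^sub>0 where \<zeta>\<^sub>0: "\<zeta>\<^sub>0 \<in> E" by blast
  let ?M = "bernoulli_product \<rho>"
  have gm: "(\<lambda>\<eta>. glue d \<eta> \<zeta>\<^sub>0) \<in> measurable ?M ?M" "(\<lambda>\<eta>. glue d \<zeta>\<^sub>0 \<eta>) \<in> measurable ?M ?M"
    unfolding measurable_cong_sets[OF refl sets_bernoulli_product] glue_def
    by (intro measurable_abs_UNIV; measurable)+
  define G where "G X = {\<eta>. glue d \<eta> \<zeta>\<^sub>0 \<in> E \<inter> X}" for X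
  define F where "F X = {\<eta>. glue d \<zeta>\<^sub>0 \<eta> \<in> E \<inter> X}" for X
  have GF: "G X \<in> sets ?M" "F X \<in> sets ?M" if "X \<in> sets ?M" for X
    using measurable_sets[OF gm(1), of "E \<inter> X"] measurable_sets[OF gm(2), of "E \<inter> X"] that
    by (auto simp: G_def F_def vimage_def)
  \<comment> \<open>The past and the future of \<open>\<eta>\<close>, each completed by the
    reference point, give \<open>\<eta>\<close> back; closure under gluing then joins the two
    separate conditions.\<close>
  have glue_glue: "glue d (glue d \<eta> \<zeta>\<^sub>0) (glue d \<zeta>\<^sub>0 \<eta>) = \<eta>" for \<eta>
    by (auto simp: glue_def)
  have rect: "E \<inter> X \<inter> Z = G X \<inter> F Z"
    if X: "\<And>\<eta> \<zeta>. \<eta> \<in> E \<Longrightarrow> \<zeta> \<in> E \<Longrightarrow> glue d \<eta> \<zeta> \<in> X \<longleftrightarrow> \<eta> \<in> X"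
      and Z: "\<And>\<eta> \<zeta>. \<eta> \<in> E \<Longrightarrow> \<zeta> \<in> E \<Longrightarrow> glue d \<eta> \<zeta> \<in> Z \<longleftrightarrow> \<zeta> \<in> Z" for X Z
  proof (intro equalityI subsetI)
    fix \<eta> assume "\<eta> \<in> E \<inter> X \<inter> Z"
    then show "\<eta> \<in> G X \<inter> F Z" using X[of \<eta> \<zeta>\<^sub>0] Z[of \<zeta>\<^sub>0 \<eta>] E \<zeta>\<^sub>0 by (simp add: G_def F_def)
  next
    fix \<eta> assume "\<eta> \<in> G X \<inter> F Z"
    then have *: "glue d \<eta> \<zeta>\<^sub>0 \<in> E" "glue d \<zeta>\<^sub>0 \<eta> \<in> E" "glue d \<eta> \<zeta>\<^sub>0 \<in> X" "glue d \<zeta>\<^sub>0 \<eta> \<in> Z"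
      by (simp_all add: G_def F_def)
    show "\<eta> \<in> E \<inter> X \<inter> Z"
      using E[OF *(1,2)] X[OF *(1,2)] Z[OF *(1,2)] *(3,4) by (simp add: glue_glue)
  qed
  have prod: "measure ?M (E \<inter> X \<inter> Z) = measure ?M (G X) * measure ?M (F Z)"
    if "\<And>\<eta> \<zeta>. \<eta> \<in> E \<Longrightarrow> \<zeta> \<in> E \<Longrightarrow> glue d \<eta> \<zeta> \<in> X \<longleftrightarrow> \<eta> \<in> X"
      and "\<And>\<eta> \<zeta>. \<eta> \<in> E \<Longrightarrow> \<zeta> \<in> E \<Longrightarrow> glue d \<eta> \<zeta> \<in> Z \<longleftrightarrow> \<zeta> \<in> Z"
      and XZ: "X \<in> sets ?M" "Z \<in> sets ?M" for X Z
  proof (subst rect, (fact that)+, rule indep_past_future[OF GF(1)[OF XZ(1)] GF(2)[OF XZ(2)], of d])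
    fix \<eta> \<zeta> assume "\<And>i. i \<le> d \<Longrightarrow> \<eta> i = \<zeta> i" "\<eta> \<in> G X"
    moreover from this(1) have "glue d \<eta> \<zeta>\<^sub>0 = glue d \<zeta> \<zeta>\<^sub>0" by (auto simp: glue_def)
    ultimately show "\<zeta> \<in> G X" by (simp add: G_def)
  next
    fix \<eta> \<zeta> assume "\<And>i. d < i \<Longrightarrow> \<eta> i = \<zeta> i" "\<eta> \<in> F Z"
    moreover from this(1) have "glue d \<zeta>\<^sub>0 \<eta> = glue d \<zeta>\<^sub>0 \<zeta>" by (auto simp: glue_def)
    ultimately show "\<zeta> \<in> F Z" by (simp add: F_def)
  qed
  have U: "UNIV \<in> sets ?M" using sets.top[of ?M] by simp
  \<comment> \<open>Each of the four measures is that of some \<open>G X\<close> times that of some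
    \<open>F Z\<close>, with \<open>X\<close> among \<open>D\<close>, \<open>UNIV\<close> and
    \<open>Z\<close> among \<open>C\<close>, \<open>UNIV\<close>; both sides are the same product of
    four factors.\<close>
  show ?thesis
    using prod[of D C] prod[of D UNIV] prod[of UNIV C] prod[of UNIV UNIV] D C U by simp
qed

text \<open>Dependence on times up to \<open>j\<close> is put as an invariance because exchanging
  futures leaves exactly these values of \<open>Y\<close> unchanged.\<close>

definition past_event :: "int \<Rightarrow> (int \<Rightarrow> int \<times> int) set \<Rightarrow> bool" where
  "past_event j D \<longleftrightarrow> D \<in> sets path_space \<and> (\<forall>f g. (\<forall>i\<le>j. f i = g i) \<longrightarrow> (f \<in> D \<longleftrightarrow> g \<in> D))"

lemma past_eventD:
  assumes "past_event j D"
  shows "D \<in> sets path_space" "(\<And>i. i \<le> j \<Longrightarrow> f i = g i) \<Longrightarrow> f \<in> D \<longleftrightarrow> g \<in> D"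
proof -
  show "D \<in> sets path_space" using assms unfolding past_event_def by (rule conjunct1)
  assume "\<And>i. i \<le> j \<Longrightarrow> f i = g i"
  then have "\<forall>i\<le>j. f i = g i" by blast
  then show "f \<in> D \<longleftrightarrow> g \<in> D"
    by (rule assms[unfolded past_event_def, THEN conjunct2, THEN spec, THEN spec, THEN mp])
qed

lemma cylinder_sets: "{f. f i \<in> C} \<in> sets path_space"
proof -
  have "{f\<in>space path_space. f i \<in> C} \<in> sets path_space"
    by (rule measurable_sets_Collect[where P = "\<lambda>y. y \<in> C", OF measurable_component_singleton]) auto
  then show ?thesis by (simp add: space_PiM)
qed

lemma Y_event_Int: "Y_event S \<inter> Y_event T = Y_event (S \<inter> T)"
  by (auto simp: Y_event_def)

lemma Y_event_markov_base:
  assumes j: "j = 0 \<or> j = 1" and D: "past_event j D"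
  shows "measure (bernoulli_product \<rho>) (Y_event ({f. f j = y} \<inter> D \<inter> {f. f (j + 1) \<in> C})) *
      measure (bernoulli_product \<rho>) (Y_event {f. f j = y}) =
    measure (bernoulli_product \<rho>) (Y_event ({f. f j = y} \<inter> D)) *
      measure (bernoulli_product \<rho>) (Y_event ({f. f j = y} \<inter> {f. f (j + 1) \<in> C}))"
proof -
  \<comment> \<open>The exchange needs a fixed coordinate: \<open>p_0 = 0\<close> for
    \<open>j = 0\<close>, and \<open>q_0 = fst y\<close> on the event
    \<open>Y_1 = y\<close>.\<close>
  define d where "d = (if j = 0 then 0 else fst y)"
  let ?E = "Y_event {f. f j = y}"
  have swap: "glue d \<eta> \<zeta> \<in> V_core \<and> (\<forall>i\<le>j. Y_proc i (glue d \<eta> \<zeta>) = Y_proc i \<eta>) \<and>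
      Y_proc (j + 1) (glue d \<eta> \<zeta>) = Y_proc (j + 1) \<zeta>" if "\<eta> \<in> ?E" "\<zeta> \<in> ?E" for \<eta> \<zeta>
    using j
  proof
    assume 0: "j = 0"
    have h: "\<eta> \<in> V_core" "\<zeta> \<in> V_core" "Y_proc 0 \<eta> = Y_proc 0 \<zeta>" and d: "d = 0"
      using that by (simp_all add: Y_event_def d_def 0)
    show ?thesis unfolding d 0 using swap_at_P[OF h] by simp
  next
    assume 1: "j = 1"
    have h: "\<eta> \<in> V_core" "\<zeta> \<in> V_core" "Y_proc 1 \<eta> = Y_proc 1 \<zeta>" and d: "d = fst (Y_proc 1 \<eta>)"
      using that by (simp_all add: Y_event_def d_def 1)
    show ?thesis unfolding d 1 using swap_at_Q[OF h] by simp
  qed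
  have "?E \<in> sets (bernoulli_product \<rho>)" using cylinder_sets[of j "{y}"] by (intro Y_event_sets) simp
  moreover have "Y_event D \<in> sets (bernoulli_product \<rho>)" by (rule Y_event_sets[OF past_eventD(1)[OF D]])
  moreover have "Y_event {f. f (j + 1) \<in> C} \<in> sets (bernoulli_product \<rho>)" by (intro Y_event_sets cylinder_sets)
  ultimately have "measure (bernoulli_product \<rho>) (?E \<inter> Y_event D \<inter> Y_event {f. f (j + 1) \<in> C}) *
      measure (bernoulli_product \<rho>) ?E =
    measure (bernoulli_product \<rho>) (?E \<inter> Y_event D) *
      measure (bernoulli_product \<rho>) (?E \<inter> Y_event {f. f (j + 1) \<in> C})"
  proof (rule measure_rectangle[where d = d])
    fix \<eta> \<zeta> assume h: "\<eta> \<in> ?E" "\<zeta> \<in> ?E"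
    note s = swap[OF h]
    have V: "\<eta> \<in> V_core" "\<zeta> \<in> V_core" using h by (simp_all add: Y_event_def)
    show "glue d \<eta> \<zeta> \<in> ?E" using s h by (simp add: Y_event_def)
    have "(\<lambda>i. Y_proc i (glue d \<eta> \<zeta>)) \<in> D \<longleftrightarrow> (\<lambda>i. Y_proc i \<eta>) \<in> D"
      by (rule past_eventD(2)[OF D]) (use s in blast)
    then show "glue d \<eta> \<zeta> \<in> Y_event D \<longleftrightarrow> \<eta> \<in> Y_event D" using s V by (simp add: Y_event_def)
    show "glue d \<eta> \<zeta> \<in> Y_event {f. f (j + 1) \<in> C} \<longleftrightarrow> \<zeta> \<in> Y_event {f. f (j + 1) \<in> C}"
      using s V by (simp add: Y_event_def)
  qed
  then show ?thesis by (simp only: Y_event_Int)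
qed

lemma Y_event_markov:
  assumes D: "past_event j D"
  shows "measure (bernoulli_product \<rho>) (Y_event ({f. f j = y} \<inter> D \<inter> {f. f (j + 1) \<in> C})) *
      measure (bernoulli_product \<rho>) (Y_event {f. f j = y}) =
    measure (bernoulli_product \<rho>) (Y_event ({f. f j = y} \<inter> D)) *
      measure (bernoulli_product \<rho>) (Y_event ({f. f j = y} \<inter> {f. f (j + 1) \<in> C}))"
proof -
  \<comment> \<open>Recentring shifts by even numbers only, so \<open>e\<close> records which kind
    of cut belongs to time \<open>j\<close>.\<close>
  define k e where "k = j div 2" and "e = j mod 2"
  have j: "j = e + 2 * k" and e: "e = 0 \<or> e = 1" by (auto simp: k_def e_def)
  define D' where "D' = {f :: int \<Rightarrow> int \<times> int. (\<lambda>i. f (i - 2 * k)) \<in> D}"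
  have D_sets: "D \<in> sets path_space" by (rule past_eventD(1)[OF D])
  have "(\<lambda>f i. f (i - 2 * k)) \<in> measurable path_space path_space"
    by (intro measurable_abs_UNIV measurable_component_singleton) simp
  from measurable_sets[OF this D_sets] have D'_sets: "D' \<in> sets path_space"
    by (simp add: D'_def vimage_def space_PiM)
  have D': "past_event e D'"
    unfolding past_event_def
  proof (intro conjI allI impI)
    fix f g :: "int \<Rightarrow> int \<times> int" assume fg: "\<forall>i\<le>e. f i = g i"
    have "(\<lambda>i. f (i - 2 * k)) \<in> D \<longleftrightarrow> (\<lambda>i. g (i - 2 * k)) \<in> D"
      by (rule past_eventD(2)[OF D]) (use fg in \<open>simp add: j\<close>)
    then show "f \<in> D' \<longleftrightarrow> g \<in> D'" by (simp add: D'_def)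
  qed (rule D'_sets)
  let ?y = "{f. f e = y}" and ?C = "{f. f (e + 1) \<in> C}"
  have sets: "?y \<in> sets path_space" "?C \<in> sets path_space"
    using cylinder_sets[of e "{y}"] cylinder_sets[of "e + 1" C] by simp_all
  have shift: "measure (bernoulli_product \<rho>) (Y_event S) =
      measure (bernoulli_product \<rho>) (Y_event {f. (\<lambda>i. f (i + 2 * k)) \<in> S})" if "S \<in> sets path_space" for S
    using Y_event_shift[OF that] by simp
  have eqs: "{f. (\<lambda>i. f (i + 2 * k)) \<in> ?y \<inter> D' \<inter> ?C} = {f. f j = y} \<inter> D \<inter> {f. f (j + 1) \<in> C}"
    "{f. (\<lambda>i. f (i + 2 * k)) \<in> ?y} = {f. f j = y}"
    "{f. (\<lambda>i. f (i + 2 * k)) \<in> ?y \<inter> D'} = {f. f j = y} \<inter> D"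
    "{f. (\<lambda>i. f (i + 2 * k)) \<in> ?y \<inter> ?C} = {f. f j = y} \<inter> {f. f (j + 1) \<in> C}"
    unfolding j D'_def by (simp_all add: Int_def add.assoc add.commute[of 1])
  show ?thesis
    using Y_event_markov_base[OF e D', where \<rho> = \<rho> and y = y and C = C]
    unfolding shift[OF sets.Int[OF sets.Int[OF sets(1) D'_sets] sets(2)]] shift[OF sets(1)]
      shift[OF sets.Int[OF sets(1) D'_sets]] shift[OF sets.Int[OF sets]] eqs .
qed

section \<open>The law of large numbers\<close>

text \<open>Take the last maximiser on \<open>{k0..k1}\<close>: later points of the interval are
  smaller by lastness, points beyond \<open>k1\<close> because they lie below
  \<open>g k0\<close>.\<close>

lemma last_maximum_ex:
  fixes g :: "int \<Rightarrow> int"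
  assumes "k0 \<le> k1" "\<And>r. k1 < r \<Longrightarrow> g r < g k0"
  obtains a where "k0 \<le> a" "a \<le> k1" "\<And>r. a < r \<Longrightarrow> g r < g a"
proof -
  define m where "m = Max (g ` {k0..k1})"
  have le_m: "g k \<le> m" if "k0 \<le> k" "k \<le> k1" for k using that by (simp add: m_def)
  have "m \<in> g ` {k0..k1}" unfolding m_def using assms(1) by (intro Max_in) auto
  then have ne: "{k\<in>{k0..k1}. g k = m} \<noteq> {}" by auto
  define a where "a = Max {k\<in>{k0..k1}. g k = m}"
  have fin: "finite {k\<in>{k0..k1}. g k = m}" by (rule finite_subset[of _ "{k0..k1}"]) auto
  have "a \<in> {k\<in>{k0..k1}. g k = m}" unfolding a_def by (rule Max_in[OF fin ne])
  then have a: "k0 \<le> a" "a \<le> k1" "g a = m" by simp_all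
  show thesis
  proof (rule that[OF a(1,2)])
    fix r assume r: "a < r"
    show "g r < g a"
    proof (cases "r \<le> k1")
      case True
      have "g r \<noteq> m"
      proof
        assume "g r = m"
        then have "r \<le> a" unfolding a_def using True r a by (intro Max_ge[OF fin]) simp
        then show False using r by simp
      qed
      then show ?thesis using le_m[of r] True r a by simp
    next
      case False
      then show ?thesis using assms(2)[of r] le_m[of k0] assms(1) a by simp
    qed
  qed
qed

text \<open>To the right of \<open>n\<close>, use an interval from \<open>n + 1\<close> to where
  \<open>g\<close> stays below \<open>g (n + 1)\<close>. To the left, \<open>g\<close> somewhere
  exceeds its bound \<open>L\<close> on the half-line from \<open>n\<close>, so a last maximum
  before \<open>n\<close> also dominates that half-line.\<close>

lemma biinfinite_last_maxima:
  fixes g :: "int \<Rightarrow> int"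
  assumes right: "\<And>L. \<exists>K. \<forall>k\<ge>K. g k < L" and left: "\<And>L. \<exists>K. \<forall>k\<le>K. L < g k"
  shows "biinfinite {a. \<forall>r>a. g r < g a}"
  unfolding biinfinite_def
proof (intro allI conjI)
  fix n
  obtain K where K: "\<And>k. K \<le> k \<Longrightarrow> g k < g (n + 1)" using right by blast
  obtain a where "n + 1 \<le> a" "\<And>r. a < r \<Longrightarrow> g r < g a"
    by (rule last_maximum_ex[of "n + 1" "max (n + 1) K" g]) (use K in auto)
  then show "\<exists>s\<in>{a. \<forall>r>a. g r < g a}. n < s" by (intro bexI[of _ a]) auto
  obtain K0 where K0: "\<And>k. K0 \<le> k \<Longrightarrow> g k < 0" using right by blast
  define L where "L = Max (insert 0 (g ` {n..K0}))"
  have L: "g k \<le> L" if "n \<le> k" for k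
  proof (cases "k \<le> K0")
    case True
    then show ?thesis unfolding L_def using that by (intro Max_ge) auto
  next
    case False
    then have "g k < 0" using K0 by simp
    moreover have "0 \<le> L" by (simp add: L_def)
    ultimately show ?thesis by simp
  qed
  obtain K1 where K1: "\<And>k. k \<le> K1 \<Longrightarrow> L < g k" using left by blast
  obtain a where "a \<le> n - 1" "\<And>r. a < r \<Longrightarrow> g r < g a"
  proof (rule last_maximum_ex[of "min K1 (n - 1)" "n - 1" g])
    show "g r < g (min K1 (n - 1))" if "n - 1 < r" for r
      using L[of r] K1[of "min K1 (n - 1)"] that by simp
  qed auto
  then show "\<exists>s\<in>{a. \<forall>r>a. g r < g a}. s < n" by (intro bexI[of _ a]) auto
qed

lemma height_forward:
  "real_of_int (height \<eta> (int N)) = real N - 2 * (\<Sum>i = 1..int N. of_bool (\<eta> i))"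
proof (induction N)
  case 0
  show ?case by (simp add: height_zero)
next
  case (Suc N)
  have "{1..int (Suc N)} = insert (int N + 1) {1..int N}" by auto
  then have "(\<Sum>i = 1..int (Suc N). of_bool (\<eta> i) :: real) = of_bool (\<eta> (int N + 1)) + (\<Sum>i = 1..int N. of_bool (\<eta> i))"
    by simp
  moreover have "height \<eta> (int (Suc N)) = height \<eta> (int N) + (-1) ^ of_bool (\<eta> (int N + 1))"
    using height_step[of \<eta> "int N + 1"] by (simp add: add.commute)
  ultimately show ?case using Suc by (cases "\<eta> (int N + 1)") simp_all
qed

text \<open>\<open>h(-N)\<close> involves the coordinates from \<open>1 - N\<close> to 0, the
  average in \<open>X_set\<close> those from \<open>-N\<close> to \<open>-1\<close>; the last two
  terms correct this mismatch.\<close>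

lemma height_backward:
  "real_of_int (height \<eta> (- int N)) =
    - real N + 2 * (\<Sum>i = - int N..-1. of_bool (\<eta> i)) - 2 * of_bool (\<eta> (- int N)) + 2 * of_bool (\<eta> 0)"
proof (induction N)
  case 0
  show ?case by (simp add: height_zero)
next
  case (Suc N)
  have "{- int (Suc N)..-1} = insert (- 1 - int N) {- int N..-1}" by auto
  then have "(\<Sum>i = - int (Suc N)..-1. of_bool (\<eta> i) :: real) =
      of_bool (\<eta> (- 1 - int N)) + (\<Sum>i = - int N..-1. of_bool (\<eta> i))"
    by simp
  moreover have "height \<eta> (- int (Suc N)) = height \<eta> (- int N) - (-1) ^ of_bool (\<eta> (- int N))"
  proof -
    have eq: "- int (Suc N) = - int N - 1" by simp
    show ?thesis unfolding eq using height_step[of \<eta> "- int N"] by linarith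
  qed
  moreover have "- int (Suc N) = - 1 - int N" by simp
  ultimately show ?case using Suc by (cases "\<eta> (- int N)") simp_all
qed

lemma at_top_eventually_int:
  fixes g :: "int \<Rightarrow> int"
  assumes "filterlim (\<lambda>N. real_of_int (g (int N))) at_top sequentially"
  shows "\<exists>K. \<forall>k\<ge>K. L < g k"
proof -
  have "eventually (\<lambda>N. real_of_int L < real_of_int (g (int N))) sequentially"
    using assms unfolding filterlim_at_top_dense by blast
  then obtain K where K: "\<And>N. K \<le> N \<Longrightarrow> L < g (int N)"
    unfolding eventually_sequentially by auto
  have "L < g k" if "int K \<le> k" for k using K[of "nat k"] that by simp
  then show ?thesis by blast
qed

lemma X_set_good_config:
  assumes \<rho>: "1 / 2 < \<rho>" "\<rho> < 2 / 3" and \<eta>: "\<eta> \<in> X_set \<rho>"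
  shows "good_config \<eta>"
proof -
  define S T where "S N = (\<Sum>i = 1..int N. of_bool (\<eta> i) :: real)"
    and "T N = (\<Sum>i = - int N..-1. of_bool (\<eta> i) :: real)" for N
  have S: "(\<lambda>N. 1 / real N * S N) \<longlonglongrightarrow> \<rho>" and T: "(\<lambda>N. 1 / real N * T N) \<longlonglongrightarrow> \<rho>"
    using \<eta> by (simp_all add: X_set_def S_def T_def)
  \<comment> \<open>The slopes \<open>2 * \<rho> - 1\<close> and \<open>4 - 6 * \<rho>\<close> are
    positive. Forward in time the expressions are \<open>-h\<close> and \<open>3 * h + k\<close>,
    backward \<open>h\<close> and \<open>-(3 * h + k)\<close>, with boundary terms
    \<open>e N\<close> and \<open>- 3 * e N\<close>. These never drop below -6; -12 is a safe
    bound.\<close>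
  have *: "filterlim (\<lambda>N. (2 * Z N - real N) + c N) at_top sequentially \<and>
      filterlim (\<lambda>N. (4 * real N - 6 * Z N) + c N) at_top sequentially"
    if Z: "(\<lambda>N. 1 / real N * Z N) \<longlonglongrightarrow> \<rho>" and c: "\<And>N. -12 \<le> c N" for Z c :: "nat \<Rightarrow> real"
  proof -
    have lim: "filterlim (\<lambda>N. (a * (1 / real N * Z N) + b) * real N) at_top sequentially"
      if "0 < a * \<rho> + b" for a b
      by (rule filterlim_tendsto_pos_mult_at_top[OF _ that filterlim_real_sequentially]) (intro tendsto_intros Z)
    have lim2: "filterlim (\<lambda>N. a * Z N + b * real N + c N) at_top sequentially"
      if "0 < a * \<rho> + b" for a b
    proof (rule filterlim_at_top_mono)
      show "filterlim (\<lambda>N. -12 + (a * (1 / real N * Z N) + b) * real N) at_top sequentially"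
        by (rule filterlim_tendsto_add_at_top[OF tendsto_const lim[OF that]])
      show "\<forall>\<^sub>F N in sequentially. -12 + (a * (1 / real N * Z N) + b) * real N \<le> a * Z N + b * real N + c N"
      proof (rule eventually_sequentiallyI[of 1])
        fix N :: nat assume "1 \<le> N"
        then have "(a * (1 / real N * Z N) + b) * real N = a * Z N + b * real N" by (simp add: algebra_simps)
        then show "-12 + (a * (1 / real N * Z N) + b) * real N \<le> a * Z N + b * real N + c N" using c[of N] by simp
      qed
    qed
    show ?thesis using lim2[of 2 "-1"] lim2[of "-6" 4] \<rho> by simp
  qed
  have hS: "real_of_int (height \<eta> (int N)) = real N - 2 * S N" for N by (simp add: S_def height_forward)
  define e where "e N = 2 * of_bool (\<eta> 0) - (2 * of_bool (\<eta> (- int N)) :: real)" for N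
  have hT: "real_of_int (height \<eta> (- int N)) = - real N + 2 * T N + e N" for N
    unfolding height_backward T_def e_def by simp
  have e: "-2 \<le> e N" "e N \<le> 2" for N by (auto simp: e_def)
  have A_right: "\<exists>K. \<forall>k\<ge>K. height \<eta> k < L" for L
    using at_top_eventually_int[of "\<lambda>k. - height \<eta> k" "- L"] *[OF S, of "\<lambda>_. 0"] by (simp add: hS)
  have B_right: "\<exists>K. \<forall>k\<ge>K. - (3 * height \<eta> k + k) < L" for L
  proof -
    have "\<exists>K. \<forall>k\<ge>K. - L < 3 * height \<eta> k + k"
    proof (rule at_top_eventually_int)
      show "filterlim (\<lambda>N. real_of_int (3 * height \<eta> (int N) + int N)) at_top sequentially"
        using *[OF S, of "\<lambda>_. 0"] by (simp add: hS algebra_simps)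
    qed
    moreover have "- L < x \<longleftrightarrow> - x < L" for x :: int by linarith
    ultimately show ?thesis by simp
  qed
  have flip: "\<exists>K. \<forall>k\<le>K. L < g k" if ex: "\<exists>K. \<forall>k\<ge>K. L < g (- k)" for g :: "int \<Rightarrow> int" and L
  proof -
    obtain K where K: "\<And>k. K \<le> k \<Longrightarrow> L < g (- k)" using ex by blast
    have "L < g k" if "k \<le> - K" for k using K[of "- k"] that by simp
    then show ?thesis by blast
  qed
  have A_left: "\<exists>K. \<forall>k\<le>K. L < height \<eta> k" for L
  proof (intro flip at_top_eventually_int)
    have "filterlim (\<lambda>N. (2 * T N - real N) + e N) at_top sequentially"
      using *[OF T, of e] e by (smt (verit))
    then show "filterlim (\<lambda>N. real_of_int (height \<eta> (- int N))) at_top sequentially"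
      by (simp add: hT algebra_simps)
  qed
  have B_left: "\<exists>K. \<forall>k\<le>K. L < - (3 * height \<eta> k + k)" for L
  proof (intro flip at_top_eventually_int)
    have "-12 \<le> - 3 * e N" for N using e[of N] by simp
    then have "filterlim (\<lambda>N. (4 * real N - 6 * T N) + - 3 * e N) at_top sequentially"
      using *[OF T, of "\<lambda>N. - 3 * e N"] by blast
    then show "filterlim (\<lambda>N. real_of_int (- (3 * height \<eta> (- int N) + - int N))) at_top sequentially"
      by (simp add: hT algebra_simps)
  qed
  have "A_set \<eta> = {a. \<forall>r>a. height \<eta> r < height \<eta> a}" by (auto simp: A_set_iff)
  \<comment> \<open>\<open>B\<close> consists of the strict last maxima of
    \<open>-(3 * h + k)\<close>, so one lemma serves both sets.\<close>
  moreover have "B_set \<eta> = {b. \<forall>r>b. - (3 * height \<eta> r + r) < - (3 * height \<eta> b + b)}"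
    unfolding set_eq_iff mem_Collect_eq B_set_iff neg_less_iff_less by blast
  ultimately show ?thesis
    using biinfinite_last_maxima[OF A_right A_left] biinfinite_last_maxima[OF B_right B_left]
    by (simp add: good_config_def)
qed

lemma V_set_eq:
  assumes "1 / 2 < \<rho>" "\<rho> < 2 / 3"
  shows "V_set \<rho> = V_core \<inter> X_set \<rho>"
  using X_set_good_config[OF assms] by (auto simp: V_set_def V_core_def)

section \<open>A strong law for coordinate averages\<close>

lemma Hoeffding_coordinates:
  assumes \<rho>: "0 \<le> \<rho>" "\<rho> \<le> 1" and I: "finite I" "I \<noteq> {}" and \<epsilon>: "0 \<le> \<epsilon>"
  shows "measure (bernoulli_product \<rho>)
      {\<eta>. \<bar>(\<Sum>i\<in>I. of_bool (\<eta> i)) / real (card I) - \<rho>\<bar> \<ge> \<epsilon>} \<le> 2 * exp (- 2 * real (card I) * \<epsilon>\<^sup>2)"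
proof -
  let ?M = "bernoulli_product \<rho>"
  interpret prob_space ?M by (rule prob_space_bernoulli_product)
  let ?b = "of_bool :: bool \<Rightarrow> real"
  have marginal: "distr ?M borel (\<lambda>\<eta>. ?b (\<eta> i)) = distr (measure_pmf (bernoulli_pmf \<rho>)) borel ?b" for i
  proof -
    have "distr (measure_pmf (bernoulli_pmf \<rho>)) borel ?b =
        distr (distr ?M (measure_pmf (bernoulli_pmf \<rho>)) (\<lambda>\<eta>. \<eta> i)) borel ?b"
      unfolding bernoulli_product_def by (subst distr_PiM_component) (auto simp: measure_pmf.prob_space_axioms)
    also have "\<dots> = distr ?M borel (\<lambda>\<eta>. ?b (\<eta> i))"
      by (subst distr_distr) (auto simp: comp_def intro!: measurable_coordinate)
    finally show ?thesis by simp
  qed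
  have exp: "expectation (\<lambda>\<eta>. ?b (\<eta> 0)) = \<rho>"
  proof -
    have "expectation (\<lambda>\<eta>. ?b (\<eta> 0)) = (\<integral>x. x \<partial>distr ?M borel (\<lambda>\<eta>. ?b (\<eta> 0)))"
      by (subst integral_distr) simp_all
    also have "\<dots> = measure_pmf.expectation (bernoulli_pmf \<rho>) ?b"
      unfolding marginal by (subst integral_distr) simp_all
    also have "\<dots> = \<rho>" using \<rho> by simp
    finally show ?thesis .
  qed
  interpret Hoeffding_ineq_iid ?M I "\<lambda>i \<eta>. ?b (\<eta> i)" "\<lambda>\<eta>. ?b (\<eta> 0)" 0 1 \<rho>
  proof unfold_locales
    show "finite I" by fact
    show "indep_vars (\<lambda>_. borel) (\<lambda>i \<eta>. ?b (\<eta> i)) I"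
      by (rule indep_vars_compose2[OF indep_vars_subset[OF indep_coordinates]]) auto
    show "distr ?M borel (\<lambda>\<eta>. ?b (\<eta> i)) = distr ?M borel (\<lambda>\<eta>. ?b (\<eta> 0))" for i
      by (simp add: marginal)
    show "\<rho> \<equiv> expectation (\<lambda>\<eta>. ?b (\<eta> 0))" by (simp add: exp)
  qed auto
  show ?thesis using Hoeffding_ineq_abs_ge'[OF \<epsilon> _ I(2)] by simp
qed

text \<open>Hoeffding's bound is geometric in \<open>N\<close>, so Borel-Cantelli applies to each
  tolerance \<open>1 / Suc m\<close>, and countably many tolerances suffice. Arbitrary index sets of
  size \<open>N\<close> cover both one-sided averages.\<close>

lemma strong_law_coordinates:
  assumes \<rho>: "0 \<le> \<rho>" "\<rho> \<le> 1" and I: "\<And>N. finite (I N)" "\<And>N. card (I N) = N"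
  shows "AE \<eta> in bernoulli_product \<rho>. (\<lambda>N. 1 / real N * (\<Sum>i\<in>I N. of_bool (\<eta> i))) \<longlonglongrightarrow> \<rho>"
proof -
  let ?M = "bernoulli_product \<rho>"
  interpret prob_space ?M by (rule prob_space_bernoulli_product)
  define avg where "avg N \<eta> = 1 / real N * (\<Sum>i\<in>I N. of_bool (\<eta> i) :: real)" for N and \<eta> :: config
  have [measurable]: "avg N \<in> borel_measurable ?M" for N unfolding avg_def by measurable
  have "AE \<eta> in ?M. \<forall>m. eventually (\<lambda>N. dist (avg N \<eta>) \<rho> < 1 / real (Suc m)) sequentially"
    unfolding AE_all_countable
  proof
    fix m
    define \<epsilon> where "\<epsilon> = 1 / real (Suc m)"
    have \<epsilon>: "0 < \<epsilon>" by (simp add: \<epsilon>_def)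
    define Bad where "Bad N = {\<eta>\<in>space ?M. \<epsilon> \<le> dist (avg N \<eta>) \<rho>}" for N
    have [measurable]: "Bad N \<in> sets ?M" for N unfolding Bad_def by measurable
    have bound: "prob (Bad N) \<le> 2 * exp (- 2 * \<epsilon>\<^sup>2) ^ N" if "1 \<le> N" for N
    proof -
      have "I N \<noteq> {}" using I(2)[of N] that by auto
      from Hoeffding_coordinates[OF \<rho> I(1) this less_imp_le[OF \<epsilon>]]
      have "prob (Bad N) \<le> 2 * exp (- 2 * real N * \<epsilon>\<^sup>2)"
        by (simp add: Bad_def avg_def I(2) dist_real_def)
      also have "exp (- 2 * real N * \<epsilon>\<^sup>2) = exp (- 2 * \<epsilon>\<^sup>2) ^ N"
        by (simp add: exp_of_nat_mult[symmetric] mult_ac)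
      finally show ?thesis .
    qed
    have "summable (\<lambda>N. prob (Bad N))"
    proof (rule summable_comparison_test_ev)
      show "\<forall>\<^sub>F N in sequentially. norm (prob (Bad N)) \<le> 2 * exp (- 2 * \<epsilon>\<^sup>2) ^ N"
        using bound by (intro eventually_sequentiallyI[of 1]) simp
      show "summable (\<lambda>N. 2 * exp (- 2 * \<epsilon>\<^sup>2) ^ N)"
        using \<epsilon> by (intro summable_mult summable_geometric) simp
    qed
    then have "AE \<eta> in ?M. eventually (\<lambda>N. \<eta> \<in> space ?M - Bad N) sequentially"
      by (intro borel_cantelli_AE1) (auto simp: emeasure_eq_measure)
    then show "AE \<eta> in ?M. eventually (\<lambda>N. dist (avg N \<eta>) \<rho> < 1 / real (Suc m)) sequentially"
      by eventually_elim (auto simp: Bad_def \<epsilon>_def elim!: eventually_mono)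
  qed
  then show ?thesis
  proof eventually_elim
    case (elim \<eta>)
    have "(\<lambda>N. avg N \<eta>) \<longlonglongrightarrow> \<rho>"
    proof (rule tendstoI)
      fix e :: real assume "0 < e"
      then obtain m where "1 / real (Suc m) < e" using nat_approx_posE by blast
      with elim[rule_format, of m] show "\<forall>\<^sub>F N in sequentially. dist (avg N \<eta>) \<rho> < e"
        by (auto elim!: eventually_mono)
    qed
    then show ?case by (simp add: avg_def)
  qed
qed

lemma X_set_sets [measurable]: "X_set \<rho> \<in> sets (bernoulli_product r)"
proof -
  have "{\<eta>\<in>space (bernoulli_product r).
     (\<lambda>N::nat. 1 / real N * (\<Sum>i = 1..int N. of_bool (\<eta> i))) \<longlonglongrightarrow> \<rho> \<and>
     (\<lambda>N::nat. 1 / real N * (\<Sum>i = - int N..-1. of_bool (\<eta> i))) \<longlonglongrightarrow> \<rho>} \<in> sets (bernoulli_product r)"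
    by measurable
  then show ?thesis by (simp add: X_set_def)
qed

lemma AE_X_set:
  assumes "0 \<le> \<rho>" "\<rho> \<le> 1"
  shows "AE \<eta> in bernoulli_product \<rho>. \<eta> \<in> X_set \<rho>"
  using strong_law_coordinates[OF assms, of "\<lambda>N. {1..int N}"] strong_law_coordinates[OF assms, of "\<lambda>N. {- int N..-1}"]
  by (auto simp: X_set_def)

text \<open>If \<open>V_core\<close> were null, so would be the union of its countably many
  translates. But almost every configuration has a point in \<open>P_set\<close>, and moving that
  point to the origin leads into \<open>V_core\<close>.\<close>

lemma prob_V_core_pos:
  assumes "1 / 2 < \<rho>" "\<rho> < 2 / 3"
  shows "0 < measure (bernoulli_product \<rho>) V_core"
proof -
  let ?M = "bernoulli_product \<rho>"
  interpret prob_space ?M by (rule prob_space_bernoulli_product)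
  have "emeasure ?M V_core \<noteq> 0"
  proof
    assume 0: "emeasure ?M V_core = 0"
    have "shift_config x -` V_core \<in> null_sets ?M" for x
      using measurable_sets[OF measurable_shift V_core_sets] emeasure_shift[OF V_core_sets] 0
      by (simp add: null_sets_def)
    then have "(\<Union>x. shift_config x -` V_core) \<in> null_sets ?M" by (rule null_sets_UN)
    then have "AE \<eta> in ?M. \<eta> \<notin> (\<Union>x. shift_config x -` V_core)" by (rule AE_not_in)
    moreover have "AE \<eta> in ?M. \<eta> \<in> X_set \<rho>" using assms by (intro AE_X_set) simp_all
    ultimately have "AE \<eta> in ?M. False"
    proof eventually_elim
      case (elim \<eta>)
      have g: "good_config \<eta>" using X_set_good_config[OF assms elim(2)] .
      then obtain x where "x \<in> P_set \<eta>" using biinfinite_P_set by (auto simp: biinfinite_def)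
      then have "shift_config x \<eta> \<in> V_core" using g by (simp add: V_core_def good_config_shift P_set_shift)
      then show ?case using elim(1) by blast
    qed
    then show False by simp
  qed
  then show ?thesis by (simp add: emeasure_eq_measure zero_less_measure_iff)
qed

section \<open>From the product formula to conditional expectations\<close>

lemma measurable_restrict_family:
  assumes "\<And>j. Y j \<in> measurable M S"
  shows "(\<lambda>\<omega>. restrict (\<lambda>i. Y i \<omega>) I) \<in> measurable M (\<Pi>\<^sub>M i\<in>I. S)"
  using assms by (intro measurable_restrict)

lemma sigma_gen_sets:
  assumes "\<And>j. Y j \<in> measurable M S"
  shows "sets (sigma_gen M S Y I) =
    {(\<lambda>\<omega>. restrict (\<lambda>i. Y i \<omega>) I) -` A \<inter> space M | A. A \<in> sets (\<Pi>\<^sub>M i\<in>I. S)}"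
  unfolding sigma_gen_def
  by (rule sets_vimage_algebra2) (use measurable_space[OF measurable_restrict_family[of Y M S I, OF assms]] in blast)

lemma sigma_gen_subalgebra:
  assumes Y: "\<And>j. Y j \<in> measurable M S"
  shows "subalgebra M (sigma_gen M S Y I)"
  unfolding subalgebra_def sigma_gen_sets[OF Y]
  using measurable_sets[OF measurable_restrict_family[of Y M S I, OF Y]] by (auto simp: sigma_gen_def)

lemma measurable_sigma_gen:
  assumes Y: "\<And>j. Y j \<in> measurable M S" and "j \<in> I"
  shows "Y j \<in> measurable (sigma_gen M S Y I) S"
proof -
  have "(\<lambda>\<omega>. restrict (\<lambda>i. Y i \<omega>) I) \<in> measurable (sigma_gen M S Y I) (\<Pi>\<^sub>M i\<in>I. S)"
    unfolding sigma_gen_def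
    by (rule measurable_vimage_algebra1) (use measurable_space[OF measurable_restrict_family[of Y M S I, OF Y]] in blast)
  from measurable_compose[OF this measurable_component_singleton[OF assms(2)]]
  show ?thesis using assms(2) by simp
qed

text \<open>The product formula avoids conditional probabilities, so states of probability 0 need no exception.\<close>

lemma markov_processI:
  fixes Y :: "int \<Rightarrow> 'w \<Rightarrow> 's :: countable"
  assumes M: "prob_space M" and Y: "\<And>j. Y j \<in> measurable M (count_space UNIV)"
    and prod: "\<And>j I D y C. I \<subseteq> {..j} \<Longrightarrow> D \<in> sets (sigma_gen M (count_space UNIV) Y I) \<Longrightarrow>
      measure M (D \<inter> {\<omega>\<in>space M. Y j \<omega> = y \<and> Y (j + 1) \<omega> \<in> C}) * measure M {\<omega>\<in>space M. Y j \<omega> = y} =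
      measure M (D \<inter> {\<omega>\<in>space M. Y j \<omega> = y}) * measure M {\<omega>\<in>space M. Y j \<omega> = y \<and> Y (j + 1) \<omega> \<in> C}"
  shows "markov_process M (count_space UNIV) Y"
  unfolding markov_process_def
proof (intro conjI allI ballI M Y)
  interpret prob_space M by (rule M)
  fix j :: int and C :: "'s set"
  define E where "E = Y (j + 1) -` C \<inter> space M"
  note Y[measurable]
  have E [measurable]: "E \<in> sets M" unfolding E_def by (rule measurable_sets[OF Y]) simp
  \<comment> \<open>The elementary conditional probability given \<open>Y_j = y\<close>; where the
    condition has probability 0, division by zero makes it 0.\<close>
  define c where "c y = prob {\<omega>\<in>space M. Y j \<omega> = y \<and> Y (j + 1) \<omega> \<in> C} / prob {\<omega>\<in>space M. Y j \<omega> = y}" for y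
  have level [measurable]: "{\<omega>\<in>space M. Y j \<omega> = y} \<in> sets M" for y
    using measurable_sets[OF Y[of j], of "{y}"] by (simp add: vimage_def Int_def conj_commute)
  have c: "0 \<le> c y" "c y \<le> 1" for y
  proof -
    show "0 \<le> c y" by (simp add: c_def)
    have "prob {\<omega>\<in>space M. Y j \<omega> = y \<and> Y (j + 1) \<omega> \<in> C} \<le> prob {\<omega>\<in>space M. Y j \<omega> = y}"
      by (intro finite_measure_mono level) auto
    then show "c y \<le> 1" unfolding c_def by (simp add: divide_le_eq_1 measure_nonneg zero_less_measure_iff)
  qed
  \<comment> \<open>Both sigma-algebras of the claim are of this kind, for \<open>I = {..j}\<close>
    and \<open>I = {j}\<close>, and both conditional expectations are versions of the same function
    of \<open>Y_j\<close>.\<close>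
  have cond_exp: "AE \<omega> in M. real_cond_exp M (sigma_gen M (count_space UNIV) Y I) (indicator E) \<omega> = c (Y j \<omega>)"
    if I: "I \<subseteq> {..j}" "j \<in> I" for I
  proof -
    let ?F = "sigma_gen M (count_space UNIV) Y I"
    interpret finite_measure_subalgebra M ?F
      by unfold_locales (rule sigma_gen_subalgebra[OF Y])
    show ?thesis
    proof (rule real_cond_exp_charact)
      have cY: "(\<lambda>\<omega>. c (Y j \<omega>)) \<in> borel_measurable M"
        using Y by (rule measurable_compose) simp
      show int_c: "integrable M (\<lambda>\<omega>. c (Y j \<omega>))"
        using c by (intro integrable_const_bound[where B = 1] cY) auto
      show int_E: "integrable M (indicat_real E)"
        using E by (intro integrable_real_indicator) (simp_all add: emeasure_eq_measure)
      show "(\<lambda>\<omega>. c (Y j \<omega>)) \<in> borel_measurable ?F"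
        using measurable_sigma_gen[OF Y I(2)] by (rule measurable_compose) simp
      fix D assume D: "D \<in> sets ?F"
      then have DM [measurable]: "D \<in> sets M" using subalg by (auto simp: subalgebra_def)
      \<comment> \<open>The set is split by the value of \<open>Y_j\<close>, coded by a natural
        number for countable additivity; a number that codes no value gives an empty piece.\<close>
      define Dn where "Dn n = D \<inter> {\<omega>\<in>space M. to_nat (Y j \<omega>) = n}" for n
      have Dn [measurable]: "Dn n \<in> sets M" for n
      proof -
        have "{\<omega>\<in>space M. to_nat (Y j \<omega>) = n} \<in> sets M"
          using measurable_sets[OF Y[of j], of "to_nat -` {n}"] by (simp add: vimage_def Int_def conj_commute)
        then show ?thesis by (simp add: Dn_def)
      qed
      have D_UN: "D = (\<Union>n. Dn n)" using sets.sets_into_space[OF DM] by (auto simp: Dn_def)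
      have disj: "\<And>m n. m \<noteq> n \<Longrightarrow> Dn m \<inter> Dn n = {}" by (auto simp: Dn_def)
      have "(\<integral>\<omega>\<in>Dn n. indicat_real E \<omega> \<partial>M) = (\<integral>\<omega>\<in>Dn n. c (Y j \<omega>) \<partial>M)" for n
      proof (cases "Dn n = {}")
        case True
        then show ?thesis by (simp add: set_lebesgue_integral_def)
      next
        case False
        then obtain y :: 's where y: "n = to_nat y" unfolding Dn_def by blast
        then have Dn_y: "Dn n = D \<inter> {\<omega>\<in>space M. Y j \<omega> = y}" by (auto simp: Dn_def)
        let ?py = "prob {\<omega>\<in>space M. Y j \<omega> = y}"
        have "(\<integral>\<omega>\<in>Dn n. indicat_real E \<omega> \<partial>M) = prob (Dn n \<inter> E)"
          by (simp add: set_lebesgue_integral_def flip: indicator_inter_arith)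
        also have "Dn n \<inter> E = D \<inter> {\<omega>\<in>space M. Y j \<omega> = y \<and> Y (j + 1) \<omega> \<in> C}" by (auto simp: Dn_y E_def)
        also have "prob \<dots> = c y * prob (Dn n)"
        proof (cases "?py = 0")
          case True
          have "prob (D \<inter> {\<omega>\<in>space M. Y j \<omega> = y \<and> Y (j + 1) \<omega> \<in> C}) \<le> ?py"
            by (intro finite_measure_mono level) auto
          then show ?thesis using True by (simp add: c_def measure_le_0_iff)
        next
          case False
          then show ?thesis using prod[OF I(1) D, of y C] by (simp add: c_def Dn_y field_simps)
        qed
        also have "\<dots> = (\<integral>\<omega>\<in>Dn n. c y \<partial>M)"
          by (simp add: set_lebesgue_integral_def)
        also have "\<dots> = (\<integral>\<omega>\<in>Dn n. c (Y j \<omega>) \<partial>M)"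
          by (intro set_lebesgue_integral_cong Dn) (simp add: Dn_y)
        finally show ?thesis .
      qed
      moreover have "(\<integral>\<omega>\<in>D. f \<omega> \<partial>M) = (\<Sum>n. \<integral>\<omega>\<in>Dn n. f \<omega> \<partial>M)" if "integrable M f" for f :: "'w \<Rightarrow> real"
        unfolding D_UN
      proof (rule lebesgue_integral_countable_add[OF Dn disj])
        show "set_integrable M (\<Union>n. Dn n) f"
          unfolding set_integrable_def by (rule integrable_mult_indicator[OF _ that]) simp
      qed
      ultimately show "(\<integral>\<omega>\<in>D. indicat_real E \<omega> \<partial>M) = (\<integral>\<omega>\<in>D. c (Y j \<omega>) \<partial>M)"
        using int_c int_E by simp
    qed
  qed
  show "AE \<omega> in M. real_cond_exp M (sigma_gen M (count_space UNIV) Y {..j}) (indicator (Y (j + 1) -` C \<inter> space M)) \<omega> =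
      real_cond_exp M (sigma_gen M (count_space UNIV) Y {j}) (indicator (Y (j + 1) -` C \<inter> space M)) \<omega>"
    using cond_exp[of "{..j}"] cond_exp[of "{j}"] unfolding E_def[symmetric] by auto
qed

theorem theorem5p11:
  fixes \<rho> :: real
  assumes "1 / 2 < \<rho>" and "\<rho> < 2 / 3"
  shows "markov_process (mu_V \<rho>) (count_space (UNIV :: (int \<times> int) set)) Y_proc"
proof -
  let ?M = "bernoulli_product \<rho>" and ?V = "V_set \<rho>" and ?U = "uniform_measure (bernoulli_product \<rho>) (V_set \<rho>)"
  interpret prob_space ?M by (rule prob_space_bernoulli_product)
  have V: "?V = V_core \<inter> X_set \<rho>" by (rule V_set_eq[OF assms])
  have V_sets [measurable]: "?V \<in> sets ?M" unfolding V by measurable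
  have AE_X: "AE \<eta> in ?M. \<eta> \<in> X_set \<rho>" using assms by (intro AE_X_set) simp_all
  \<comment> \<open>\<open>X_set\<close> has full measure, so the product formula on
    \<open>V_core\<close> carries over to \<open>V_set\<close>.\<close>
  have V_core_V: "prob (?V \<inter> E) = prob (V_core \<inter> E)" if "E \<in> sets ?M" for E
    by (rule measure_eq_AE) (use AE_X that in \<open>auto simp: V\<close>)
  have pos: "0 < prob ?V" using V_core_V[of UNIV] prob_V_core_pos[OF assms] sets.top[of ?M] by simp
  then have V0: "emeasure ?M ?V \<noteq> 0" "emeasure ?M ?V \<noteq> \<infinity>" by (simp_all add: emeasure_eq_measure)
  have space_V: "space (mu_V \<rho>) = ?V" by (simp add: mu_V_def space_restrict_space)
  have prob_V: "measure (mu_V \<rho>) (?V \<inter> E) = prob (V_core \<inter> E) / prob ?V" if "E \<in> sets ?M" for E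
    unfolding mu_V_def using V0 that
    by (subst measure_restrict_space) (auto simp: V_core_V)
  have Y: "Y_proc j \<in> measurable (mu_V \<rho>) (count_space UNIV)" for j
  proof -
    have "sets (mu_V \<rho>) = sets (restrict_space (restrict_space ?M V_core) ?V)"
    proof -
      have "restrict_space (restrict_space ?M V_core) ?V = restrict_space ?M ?V"
        by (subst restrict_restrict_space) (auto simp: V Int_absorb1 intro!: arg_cong[where f = "restrict_space ?M"])
      then show ?thesis by (simp add: mu_V_def sets_restrict_space)
    qed
    from measurable_cong_sets[OF this refl] show ?thesis
      using measurable_restrict_space1[OF measurable_Y_proc] by blast
  qed
  show ?thesis
  proof (rule markov_processI[OF _ Y])
    show "prob_space (mu_V \<rho>)"
      unfolding mu_V_def using pos
      by (intro prob_space_restrict_space) (simp_all add: emeasure_eq_measure divide_ennreal)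
    fix j I D and y :: "int \<times> int" and C
    assume I: "I \<subseteq> {..j}" and "D \<in> sets (sigma_gen (mu_V \<rho>) (count_space UNIV) Y_proc I)"
    then obtain A where A: "A \<in> sets (\<Pi>\<^sub>M i\<in>I. count_space UNIV)"
      and D: "D = (\<lambda>\<eta>. restrict (\<lambda>i. Y_proc i \<eta>) I) -` A \<inter> ?V"
      unfolding sigma_gen_sets[OF Y] space_V by auto
    \<comment> \<open>\<open>D\<close> is given by the coordinates in \<open>I\<close>;
      \<open>D'\<close> lifts it to whole paths, where being an event of the past is tested by
      changing later values.\<close>
    define D' where "D' = {f :: int \<Rightarrow> int \<times> int. restrict f I \<in> A}"
    have "(\<lambda>f. restrict f I) \<in> measurable path_space (\<Pi>\<^sub>M i\<in>I. count_space UNIV)"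
      by (rule measurable_restrict_subset) simp
    from measurable_sets[OF this A] have D'_sets: "D' \<in> sets path_space"
      by (simp add: D'_def vimage_def space_PiM)
    have past: "past_event j D'"
      unfolding past_event_def
    proof (intro conjI allI impI D'_sets)
      fix f g :: "int \<Rightarrow> int \<times> int" assume "\<forall>i\<le>j. f i = g i"
      then have "restrict f I = restrict g I" using I by (auto simp: restrict_def fun_eq_iff)
      then show "f \<in> D' \<longleftrightarrow> g \<in> D'" by (simp add: D'_def)
    qed
    have eq: "measure (mu_V \<rho>) (?V \<inter> Y_event S) = prob (Y_event S) / prob ?V" if "S \<in> sets path_space" for S
    proof -
      have "V_core \<inter> Y_event S = Y_event S" by (auto simp: Y_event_def)
      then show ?thesis using prob_V[OF Y_event_sets[OF that]] by simp
    qed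
    let ?y = "{f :: int \<Rightarrow> int \<times> int. f j = y}" and ?C = "{f :: int \<Rightarrow> int \<times> int. f (j + 1) \<in> C}"
    have sets: "?y \<in> sets path_space" "?C \<in> sets path_space"
      using cylinder_sets[of j "{y}"] cylinder_sets[of "j + 1" C] by simp_all
    have events:
      "D \<inter> {\<eta>\<in>space (mu_V \<rho>). Y_proc j \<eta> = y \<and> Y_proc (j + 1) \<eta> \<in> C} = ?V \<inter> Y_event (?y \<inter> D' \<inter> ?C)"
      "{\<eta>\<in>space (mu_V \<rho>). Y_proc j \<eta> = y} = ?V \<inter> Y_event ?y"
      "D \<inter> {\<eta>\<in>space (mu_V \<rho>). Y_proc j \<eta> = y} = ?V \<inter> Y_event (?y \<inter> D')"
      "{\<eta>\<in>space (mu_V \<rho>). Y_proc j \<eta> = y \<and> Y_proc (j + 1) \<eta> \<in> C} = ?V \<inter> Y_event (?y \<inter> ?C)"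
      by (auto simp: space_V D D'_def Y_event_def V)
    show "measure (mu_V \<rho>) (D \<inter> {\<eta>\<in>space (mu_V \<rho>). Y_proc j \<eta> = y \<and> Y_proc (j + 1) \<eta> \<in> C}) *
        measure (mu_V \<rho>) {\<eta>\<in>space (mu_V \<rho>). Y_proc j \<eta> = y} =
      measure (mu_V \<rho>) (D \<inter> {\<eta>\<in>space (mu_V \<rho>). Y_proc j \<eta> = y}) *
        measure (mu_V \<rho>) {\<eta>\<in>space (mu_V \<rho>). Y_proc j \<eta> = y \<and> Y_proc (j + 1) \<eta> \<in> C}"
      \<comment> \<open>Conditioning divides each of the four probabilities by
        \<open>prob ?V\<close>, so both sides acquire the same factor.\<close>
      unfolding events(1,3) unfolding events(2,4) eq[OF sets(1)] eq[OF sets.Int[OF sets]] eq[OF sets.Int[OF sets(1) D'_sets]]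
        eq[OF sets.Int[OF sets.Int[OF sets(1) D'_sets] sets(2)]]
      using Y_event_markov[OF past, where \<rho> = \<rho> and y = y and C = C] by simp
  qed
qed

end
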